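(* Let $\pi\in S_n$, $\pi\ne 1$, be presented in its standard OGS elementary factorization $\pi=\prod_{v=1}^{z(\pi)}\pi^{(v)}$, $\pi^{(v)}=\prod_{j=1}^{m^{(v)}}t_{h^{(v)}_{j}}^{\imath_{j}^{(v)}}$, and for $1\le v\le z(\pi)$, $1\le j\le m^{(v)}$ let $\vartheta^{(v)}_j$, $\kappa^{(v)}_{-;j}$, $\kappa^{(v)}_{+;j}$, $\eta^{(v)}_j$ be the non-negative integers defined in the context. Then the standard OGS canonical form of $\pi^{-1}$ is $\prod_{\tilde j=1}^{\tilde{m}}t_{\tilde{k}_{\tilde j}}^{\tilde{i}_{\tilde{k}_{\tilde j}}}$ (up to omission of factors with exponent $0$), where $\tilde k_1<\cdots<\tilde k_{\tilde m}$ are the distinct non-zero values among the numbers $\kappa^{(v)}_{-;j}$ and $\kappa^{(v)}_{+;j}$ ($1\le v\le z(\pi)$, $1\le j\le m^{(v)}$), and for every $1\le\tilde j\le\tilde m$: (1) if $\tilde{k}_{\tilde{j}}=\kappa^{(v)}_{+;j}$ for some $v,j$, then $\tilde{i}_{\tilde{k}_{\tilde{j}}}=\sum_{\gamma}\left(\vartheta^{(v_{\gamma})}_{j_{\gamma}}+\eta^{(v_{\gamma})}_{j_{\gamma}}\right)$, the sum being over all pairs $(v_\gamma,j_\gamma)$ with $\kappa^{(v_{\gamma})}_{+;j_{\gamma}}=\kappa^{(v)}_{+;j}$; (2) if $\tilde{k}_{\tilde{j}}=\kappa^{(v)}_{-;j}$ for some $v,j$, then $\tilde{i}_{\tilde{k}_{\tilde{j}}}=\kappa^{(v)}_{-;j}-\sum_{\gamma}\left(\vartheta^{(v_{\gamma})}_{j_{\gamma}}+\eta^{(v_{\gamma})}_{j_{\gamma}-1}\right)$,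 the sum being over all pairs $(v_\gamma,j_\gamma)$ with $\kappa^{(v_{\gamma})}_{-;j_{\gamma}}=\kappa^{(v)}_{-;j}$. Moreover: (3) $z(\pi^{-1})$, the number of standard OGS elementary factors of $\pi^{-1}$, equals the number of different non-zero values $\kappa^{(v)}_{-;j}$, $1\leq v\leq z(\pi)$, $1\leq j\leq m^{(v)}$; (4) for every $1\leq w\leq z(\pi^{-1})$, the $w$-th standard OGS elementary factor $(\pi^{-1})^{(w)}$ of $\pi^{-1}$ satisfies $maj\left((\pi^{-1})^{(w)}\right)=\kappa^{(v)}_{-;j}$ for some $v,j$, and for every given non-zero value of $\kappa^{(v)}_{-;j}$ there is exactly one $w$ such that $maj\left((\pi^{-1})^{(w)}\right)=\kappa^{(v)}_{-;j}$ (i.e. there is a one-to-one correspondence between the different non-zero values of $\kappa^{(v)}_{-;j}$ and the descent set of $\pi^{-1}$).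
   Context: $S_n$ is the group of permutations of $\{1,\dots,n\}$, with products taken from left to right: $(\pi_1\cdot\pi_2)(i)=\pi_2(\pi_1(i))$. $s_i$ is the transposition $(i,i+1)$. The descent set is $des(\pi)=\{1\le i\le n-1: \pi(i)>\pi(i+1)\}$ and $maj(\pi)=\sum_{i\in des(\pi)}i$. For $2\le m\le n$, $t_m=s_1s_2\cdots s_{m-1}$; put $t_1=1$. Every element of $S_n$ has a unique presentation $t_2^{i_2}t_3^{i_3}\cdots t_n^{i_n}$ with $0\le i_k<k$ (the standard OGS canonical form); one often writes only the factors with non-zero exponent. By a theorem of Adin and Roichman, $maj(\pi)$ equals the sum of the exponents in this form. A non-identity element $\prod_{j=1}^m t_{k_j}^{i_{k_j}}$ in this form, with $k_1<\cdots<k_m$ and all $i_{k_j}>0$, is a standard OGS elementary element if $\sum_{j=1}^m i_{k_j}\le k_1$. The standard OGS elementary factorization of $\pi\neq1$ is the presentation $\pi=\prod_{v=1}^{z(\pi)}\pi^{(v)}$ as a product of standard OGS elementary elements (the standard OGS elementary factors) $\pi^{(v)}=\prod_{j=1}^{m^{(v)}}t_{h^{(v)}_{j}}^{\imath_{j}^{(v)}}$, each in its standard OGS canonical form ($h^{(v)}_1<\cdots<h^{(v)}_{m^{(v)}}$, $0<\imath^{(v)}_j<h^{(v)}_j$), with $maj(\pi^{(1)})\le h^{(1)}_1$ and $h^{(v-1)}_{m^{(v-1)}}\le maj(\pi^{(v)})\le h^{(v)}_1$ for $2\le v\le z(\pi)$, where $maj(\pi^{(v)})=\sum_{j}\imath_j^{(v)}$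 and $z(\pi)$ is the minimal number of factors for which this is possible. It exists and is unique. Parameters. For $1\le v\le z(\pi)$, $1\le j\le m^{(v)}$: $\varrho^{(v)}_j=\sum_{x=1}^{j}\imath^{(v)}_x$, $\varrho^{(v)}_0=0$, $\vartheta^{(v)}_j=h^{(v)}_j-maj(\pi^{(v)})$. For $v\le r\le z(\pi)$ define $\kappa^{(v\to r)}_{\pm;j}$ recursively: $\kappa^{(v\to v)}_{-;j}=\vartheta^{(v)}_j+\varrho^{(v)}_{j-1}$, $\kappa^{(v\to v)}_{+;j}=\vartheta^{(v)}_j+\varrho^{(v)}_{j}$; if $\varrho^{(r+1)}_{j'-1}\le\kappa^{(v\to r)}_{-;j}<\varrho^{(r+1)}_{j'}$ for $1\le j'\le m^{(r+1)}$, then $\kappa^{(v\to r+1)}_{-;j}=\kappa^{(v\to r)}_{-;j}+\vartheta^{(r+1)}_{j'}$; if $\varrho^{(r+1)}_{j''-1}<\kappa^{(v\to r)}_{+;j}\le\varrho^{(r+1)}_{j''}$ for $1\le j''\le m^{(r+1)}$, then $\kappa^{(v\to r+1)}_{+;j}=\kappa^{(v\to r)}_{+;j}+\vartheta^{(r+1)}_{j''}$. Put $\kappa^{(v)}_{\pm;j}=\kappa^{(v\to z(\pi))}_{\pm;j}$. For $1\le v\le z(\pi)$, $1\le j<m^{(v)}$, let $\chi^{(v)}_j$ be the largest $v'$ with $1\le v'<v$ such that one of the following holds: $\kappa^{(v')}_{+;j'}\le\kappa^{(v)}_{+;j}<\kappa^{(v')}_{-;j'+1}$ for some $1\le j'<m^{(v')}$;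 or $\kappa^{(v)}_{+;j}<\kappa^{(v')}_{-;1}$; or $\kappa^{(v')}_{+;m^{(v')}}\le\kappa^{(v)}_{+;j}$. If no such $v'$ exists, $\chi^{(v)}_j=0$. For $1\le v\le z(\pi)$, $1\le j<m^{(v)}$, let $\eta^{(v)}_j=\sum_{v'=\chi^{(v)}_j+1}^{v-1}\vartheta^{(v')}_{j_{v'}}$, where $j_{v'}\in\{1,\dots,m^{(v')}\}$ is the index such that $\kappa^{(v')}_{-;j_{v'}}<\kappa^{(v)}_{+;j}<\kappa^{(v')}_{+;j_{v'}}$. By convention $\eta^{(v)}_0=0$ and $\eta^{(v)}_{m^{(v)}}=0$. *)

theory Defs
  imports "HOL-Combinatorics.Permutations"
begin

text \<open>
  Elements of \<open>S\<^sub>n\<close> are functions \<open>p\<close> with \<open>p permutes {1..n}\<close>.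
  All indices \<open>v\<close>, \<open>j\<close>, \<open>r\<close>, \<open>w\<close> below start at 1.
\<close>

text \<open>Products are taken from left to right.\<close>

definition pmult :: "(nat \<Rightarrow> nat) \<Rightarrow> (nat \<Rightarrow> nat) \<Rightarrow> nat \<Rightarrow> nat" where
  "pmult p q = (\<lambda>i. q (p i))"

definition pprod :: "(nat \<Rightarrow> nat) list \<Rightarrow> nat \<Rightarrow> nat" where
  "pprod ps = foldr pmult ps id"

definition des :: "nat \<Rightarrow> (nat \<Rightarrow> nat) \<Rightarrow> nat set" where
  "des n p = {i. 1 \<le> i \<and> i \<le> n - 1 \<and> p i > p (i + 1)}"

definition maj :: "nat \<Rightarrow> (nat \<Rightarrow> nat) \<Rightarrow> nat" where
  "maj n p = (\<Sum>i\<in>des n p. i)"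

definition adj_transp :: "nat \<Rightarrow> nat \<Rightarrow> nat" where
  "adj_transp i = Transposition.transpose i (i + 1)"

definition ogs_gen :: "nat \<Rightarrow> nat \<Rightarrow> nat" where
  "ogs_gen m = pprod (map adj_transp [1..<m])"

text \<open>A list \<open>[(k\<^sub>1, i\<^sub>1), \<dots>, (k\<^sub>m, i\<^sub>m)]\<close> stands for the product of the powers of the generators \<open>t\<close>
  with index \<open>k\<^sub>j\<close> and exponent \<open>i\<^sub>j\<close>.\<close>

type_synonym ogs_word = "(nat \<times> nat) list"

definition ogs_prod :: "ogs_word \<Rightarrow> nat \<Rightarrow> nat" where
  "ogs_prod xs = pprod (map (\<lambda>(k, i). ogs_gen k ^^ i) xs)"

text \<open>Canonical forms are written without the factors of exponent zero.\<close>

definition ogs_canonical :: "nat \<Rightarrow> ogs_word \<Rightarrow> bool" where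
  "ogs_canonical n xs \<longleftrightarrow>
     sorted_wrt (<) (map fst xs) \<and> (\<forall>(k, i)\<in>set xs. 2 \<le> k \<and> k \<le> n \<and> 0 < i \<and> i < k)"

definition ogs_elementary :: "nat \<Rightarrow> ogs_word \<Rightarrow> bool" where
  "ogs_elementary n xs \<longleftrightarrow>
     ogs_canonical n xs \<and> xs \<noteq> [] \<and> sum_list (map snd xs) \<le> fst (hd xs)"

definition fac_m :: "ogs_word list \<Rightarrow> nat \<Rightarrow> nat" where
  "fac_m F v = length (F ! (v - 1))"

definition fac_h :: "ogs_word list \<Rightarrow> nat \<Rightarrow> nat \<Rightarrow> nat" where
  "fac_h F v j = fst (F ! (v - 1) ! (j - 1))"

definition fac_i :: "ogs_word list \<Rightarrow> nat \<Rightarrow> nat \<Rightarrow> nat" where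
  "fac_i F v j = snd (F ! (v - 1) ! (j - 1))"

definition fac_maj :: "nat \<Rightarrow> ogs_word list \<Rightarrow> nat \<Rightarrow> nat" where
  "fac_maj n F v = maj n (ogs_prod (F ! (v - 1)))"

definition ogs_elementary_presentation :: "nat \<Rightarrow> (nat \<Rightarrow> nat) \<Rightarrow> ogs_word list \<Rightarrow> bool" where
  "ogs_elementary_presentation n p F \<longleftrightarrow>
     p = pprod (map ogs_prod F) \<and>
     (\<forall>xs\<in>set F. ogs_elementary n xs) \<and>
     (F \<noteq> [] \<longrightarrow> fac_maj n F 1 \<le> fac_h F 1 1) \<and>
     (\<forall>v\<in>{2..length F}.
        fac_h F (v - 1) (fac_m F (v - 1)) \<le> fac_maj n F v \<and> fac_maj n F v \<le> fac_h F v 1)"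

definition ogs_z :: "nat \<Rightarrow> (nat \<Rightarrow> nat) \<Rightarrow> nat" where
  "ogs_z n p = (LEAST z. \<exists>F. ogs_elementary_presentation n p F \<and> length F = z)"

definition ogs_elementary_factorization :: "nat \<Rightarrow> (nat \<Rightarrow> nat) \<Rightarrow> ogs_word list \<Rightarrow> bool" where
  "ogs_elementary_factorization n p F \<longleftrightarrow>
     ogs_elementary_presentation n p F \<and> length F = ogs_z n p"

definition fac_index :: "ogs_word list \<Rightarrow> (nat \<times> nat) set" where
  "fac_index F = {(v, j). 1 \<le> v \<and> v \<le> length F \<and> 1 \<le> j \<and> j \<le> fac_m F v}"

definition rho :: "ogs_word list \<Rightarrow> nat \<Rightarrow> nat \<Rightarrow> nat" where
  "rho F v j = (\<Sum>x=1..j. fac_i F v x)"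

text \<open>The subtraction does not truncate in an elementary factorization, since there
  \<open>fac_maj n F v \<le> fac_h F v 1 \<le> fac_h F v j\<close>.\<close>

definition theta :: "nat \<Rightarrow> ogs_word list \<Rightarrow> nat \<Rightarrow> nat \<Rightarrow> nat" where
  "theta n F v j = fac_h F v j - fac_maj n F v"

text \<open>\<open>kappa_minus_steps n F v j d\<close> and \<open>kappa_plus_steps n F v j d\<close> are the numbers \<open>\<kappa>\<close> for the step
  from \<open>v\<close> to \<open>v + d\<close>. In an elementary factorization, the index selected by \<open>THE\<close> exists and is
  unique whenever \<open>(v, j) \<in> fac_index F\<close> and \<open>v + Suc d \<le> length F\<close>.\<close>

primrec kappa_minus_steps :: "nat \<Rightarrow> ogs_word list \<Rightarrow> nat \<Rightarrow> nat \<Rightarrow> nat \<Rightarrow> nat" where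
  "kappa_minus_steps n F v j 0 = theta n F v j + rho F v (j - 1)"
| "kappa_minus_steps n F v j (Suc d) =
     kappa_minus_steps n F v j d +
     theta n F (v + Suc d)
       (THE j'. 1 \<le> j' \<and> j' \<le> fac_m F (v + Suc d) \<and>
          rho F (v + Suc d) (j' - 1) \<le> kappa_minus_steps n F v j d \<and>
          kappa_minus_steps n F v j d < rho F (v + Suc d) j')"

primrec kappa_plus_steps :: "nat \<Rightarrow> ogs_word list \<Rightarrow> nat \<Rightarrow> nat \<Rightarrow> nat \<Rightarrow> nat" where
  "kappa_plus_steps n F v j 0 = theta n F v j + rho F v j"
| "kappa_plus_steps n F v j (Suc d) =
     kappa_plus_steps n F v j d +
     theta n F (v + Suc d)
       (THE j'. 1 \<le> j' \<and> j' \<le> fac_m F (v + Suc d) \<and>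
          rho F (v + Suc d) (j' - 1) < kappa_plus_steps n F v j d \<and>
          kappa_plus_steps n F v j d \<le> rho F (v + Suc d) j')"

definition kappa_minus :: "nat \<Rightarrow> ogs_word list \<Rightarrow> nat \<Rightarrow> nat \<Rightarrow> nat" where
  "kappa_minus n F v j = kappa_minus_steps n F v j (length F - v)"

definition kappa_plus :: "nat \<Rightarrow> ogs_word list \<Rightarrow> nat \<Rightarrow> nat \<Rightarrow> nat" where
  "kappa_plus n F v j = kappa_plus_steps n F v j (length F - v)"

definition chi :: "nat \<Rightarrow> ogs_word list \<Rightarrow> nat \<Rightarrow> nat \<Rightarrow> nat" where
  "chi n F v j = Max (insert 0 {v'. 1 \<le> v' \<and> v' < v \<and>
     ((\<exists>j'. 1 \<le> j' \<and> j' < fac_m F v' \<and>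
         kappa_plus n F v' j' \<le> kappa_plus n F v j \<and>
         kappa_plus n F v j < kappa_minus n F v' (j' + 1)) \<or>
      kappa_plus n F v j < kappa_minus n F v' 1 \<or>
      kappa_plus n F v' (fac_m F v') \<le> kappa_plus n F v j)})"

definition eta :: "nat \<Rightarrow> ogs_word list \<Rightarrow> nat \<Rightarrow> nat \<Rightarrow> nat" where
  "eta n F v j =
     (if j = 0 \<or> j = fac_m F v then 0
      else (\<Sum>v'=chi n F v j + 1..v - 1.
        theta n F v' (THE j'. 1 \<le> j' \<and> j' \<le> fac_m F v' \<and>
          kappa_minus n F v' j' < kappa_plus n F v j \<and>
          kappa_plus n F v j < kappa_plus n F v' j')))"

definition kappa_minus_values :: "nat \<Rightarrow> ogs_word list \<Rightarrow> nat set" where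
  "kappa_minus_values n F = {kappa_minus n F v j | v j. (v, j) \<in> fac_index F} - {0}"

definition kappa_values :: "nat \<Rightarrow> ogs_word list \<Rightarrow> nat set" where
  "kappa_values n F =
     ({kappa_minus n F v j | v j. (v, j) \<in> fac_index F} \<union>
      {kappa_plus n F v j | v j. (v, j) \<in> fac_index F}) - {0}"

end

theory Submission
  imports Defs
begin

text \<open>
  Let \<open>q = inv p\<close>. The proof reads the canonical form of \<open>q\<close> off the positions of neighbouring values
  \<open>k\<close> and \<open>k + 1\<close> in \<open>p\<close>, and it reads those positions off the factors of \<open>p\<close>.

  An elementary factor is an explicit permutation (\<open>factor_block\<close>, \<open>factor_mono_high\<close>). If \<open>M\<close> is the sum
  of its exponents, it translates the block from \<open>\<rho> (j - 1) + 1\<close> to \<open>\<rho> j\<close> by \<open>\<theta> j\<close> for every \<open>j\<close>, and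
  it is increasing on the points above \<open>M\<close>; so \<open>M\<close> is its only descent. The conditions
  on a factorization say that the first \<open>v - 1\<close> factors only permute points up to \<open>M v\<close>. Hence the product
  of the factors from the \<open>v\<close>-th on, called \<open>tail_prod v\<close>, is \<open>p\<close> with its first \<open>M v\<close> entries sorted,
  and \<open>p\<close> is increasing on each of the runs of positions from \<open>M (v - 1) + 1\<close> to \<open>M v\<close>. The recursion
  for \<open>\<kappa>\<close> follows the two ends of a block through the later factors, so that \<open>\<kappa>\<^sub>- + 1\<close> and \<open>\<kappa>\<^sub>+\<close> are the
  images of these ends under \<open>tail_prod v\<close>.

  For an arbitrary permutation \<open>q\<close>, the exponent of the generator with index \<open>k\<close> in the canonical form is the
  number of \<open>x < k\<close> for which \<open>q x\<close> is met strictly between \<open>q k\<close> and \<open>q (k + 1)\<close> when one walks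
  cyclically from the former up to the latter (\<open>ogs_prod_ogs_exponents\<close>). In terms of the ranks
  \<open>rank_below q k y\<close>, the number of \<open>x \<le> k\<close> with \<open>q x \<le> y\<close>, this is
  the rank at \<open>y = q (k + 1)\<close> minus the rank at \<open>y = q k\<close>, increased by \<open>k\<close> if \<open>k\<close> is a descent.
  Now let \<open>q = inv p\<close>, and let \<open>a\<close> and \<open>b\<close> be the runs that contain the positions of \<open>k\<close> and \<open>k + 1\<close>.
  As \<open>p\<close> increases on runs, both ranks may be taken at the ends of the runs, where they are the places
  of \<open>k\<close> in \<open>tail_prod b\<close> and in \<open>tail_prod a\<close>. From one tail product to the next, the place of a value
  grows by the translation \<open>\<theta>\<close> of the block that contains it. So for \<open>a < b\<close> the exponent is the sum of
  these translations over the factors \<open>a, \<dots>, b - 1\<close>. Among these factors, those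
  in which \<open>k\<close> ends its block are the pairs with \<open>\<kappa>\<^sub>+ = k\<close>, and \<open>\<eta>\<close> adds up the translations in the
  factors that lie between two such pairs. This is the first formula. For \<open>b < a\<close>, which means that \<open>k\<close> is a
  descent of \<open>q\<close>, the same computation with \<open>k + 1\<close> and with the starts of blocks gives the second.
  If \<open>a = b\<close>, then the exponent is zero, and \<open>k\<close> is no \<open>\<kappa>\<close>.

  In particular, the descents of \<open>q\<close> are the non-zero values \<open>\<kappa>\<^sub>-\<close>. The claims on the factorization of \<open>q\<close>
  follow since the descents of any permutation are among the major indices of the factors of any
  presentation (\<open>des_subset_fac_maj\<close>), while splitting off the largest descent again and again produces a
  presentation with one factor for every descent (\<open>presentation_exists\<close>).
\<close>

section \<open>Products of powers of the generators\<close>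

lemma pprod_simps [simp]: "pprod [] x = x" "pprod (p # ps) x = pprod ps (p x)"
  by (simp_all add: pprod_def pmult_def)

lemma pprod_append [simp]: "pprod (ps @ qs) x = pprod qs (pprod ps x)"
  by (induction ps arbitrary: x) auto

lemma ogs_prod_simps [simp]:
  "ogs_prod [] x = x"
  "ogs_prod (ki # xs) x = ogs_prod xs ((ogs_gen (fst ki) ^^ snd ki) x)"
  by (simp_all add: ogs_prod_def case_prod_beta)

lemma ogs_prod_append [simp]: "ogs_prod (xs @ ys) x = ogs_prod ys (ogs_prod xs x)"
  by (simp add: ogs_prod_def)

lemma ogs_gen_apply:
  "ogs_gen k x = (if 1 \<le> x \<and> x \<le> k then if x = 1 then k else x - 1 else x)"
proof (induction k arbitrary: x)
  case 0
  then show ?case by (simp add: ogs_gen_def)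
next
  case (Suc k)
  show ?case
  proof (cases "k = 0")
    case True
    then show ?thesis by (auto simp: ogs_gen_def)
  next
    case False
    then have "ogs_gen (Suc k) x = adj_transp k (ogs_gen k x)"
      by (simp add: ogs_gen_def)
    then show ?thesis
      using False by (auto simp: Suc.IH adj_transp_def Transposition.transpose_def)
  qed
qed

text \<open>The generator with index \<open>k\<close> rotates \<open>1, \<dots>, k\<close> downwards by one place, so its \<open>c\<close>-th power
  moves the first \<open>c\<close> points to the top and everything else down by \<open>c\<close>.\<close>
lemma ogs_gen_power_apply:
  assumes "c \<le> k"
  shows "(ogs_gen k ^^ c) x =
    (if 1 \<le> x \<and> x \<le> c then x + k - c else if c < x \<and> x \<le> k then x - c else x)"
  using assms
proof (induction c)
  case (Suc c)
  then have eq: "(ogs_gen k ^^ Suc c) x = ogs_gen k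
    (if 1 \<le> x \<and> x \<le> c then x + k - c else if c < x \<and> x \<le> k then x - c else x)"
    by simp
  show ?case
    unfolding eq using Suc.prems by (auto simp: ogs_gen_apply)
qed auto

lemma permutes_le_iff:
  assumes "f permutes {1..b}"
  shows "f x \<le> b \<longleftrightarrow> x \<le> (b::nat)"
proof (cases "x = 0")
  case True
  then show ?thesis using permutes_not_in[OF assms, of 0] by simp
next
  case False
  then show ?thesis
    using permutes_in_image[OF assms, of x] permutes_not_in[OF assms, of x]
    by (cases "x \<le> b") auto
qed

lemma permutes_ge_1:
  assumes "f permutes {1..b}" "1 \<le> x"
  shows "1 \<le> f (x::nat)"
  using permutes_in_image[OF assms(1), of x] permutes_not_in[OF assms(1), of x] assms(2)
  by (cases "x \<in> {1..b}") auto

lemma ogs_gen_permutes: "ogs_gen k permutes {1..k}"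
proof -
  have "bij_betw (ogs_gen k) {1..k} {1..k}"
    by (rule bij_betw_byWitness[where f' = "\<lambda>x. if x = k then 1 else x + 1"])
      (auto simp: ogs_gen_apply)
  then show ?thesis
    by (intro bij_imp_permutes) (auto simp: ogs_gen_apply)
qed

lemma ogs_gen_power_permutes: "ogs_gen k ^^ c permutes {1..k}"
proof (induction c)
  case 0
  show ?case
    by (simp add: permutes_def)
next
  case (Suc c)
  then show ?case
    by (metis funpow.simps(2) ogs_gen_permutes permutes_compose)
qed

lemma pprod_permutes:
  assumes "\<And>p. p \<in> set ps \<Longrightarrow> p permutes S"
  shows "pprod ps permutes S"
  using assms
proof (induction ps)
  case Nil
  then show ?case by (simp add: pprod_def permutes_id[unfolded id_def] id_def)
next
  case (Cons p ps)
  then have "pprod ps \<circ> p permutes S"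
    by (intro permutes_compose) auto
  moreover have "pprod ps \<circ> p = pprod (p # ps)"
    by (rule ext) simp
  ultimately show ?case by metis
qed

lemma ogs_prod_permutes:
  assumes "\<And>k i. (k, i) \<in> set xs \<Longrightarrow> k \<le> n"
  shows "ogs_prod xs permutes {1..n}"
  unfolding ogs_prod_def
proof (rule pprod_permutes)
  fix p
  assume "p \<in> set (map (\<lambda>(k, i). ogs_gen k ^^ i) xs)"
  then obtain k i where "(k, i) \<in> set xs" and p: "p = ogs_gen k ^^ i"
    by auto
  then have "{1..k} \<subseteq> {1..n}"
    using assms by auto
  then show "p permutes {1..n}"
    using ogs_gen_power_permutes p permutes_subset by blast
qed

text \<open>The next three lemmas describe the product of a word whose exponents add up to \<open>M \<le> H\<close>, where \<open>H\<close>
  bounds all indices from below. They go by induction on the last letter. The idea is that a point above \<open>M\<close> never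
  falls among the points that a letter moves to the top: until its turn comes, the block of a letter
  is only moved down, by the exponents of the earlier letters.\<close>
lemma elementary_word_low:
  assumes "\<And>k i. (k, i) \<in> set xs \<Longrightarrow> H \<le> k"
    and "sum_list (map snd xs) < x" "x \<le> H"
  shows "ogs_prod xs x = x - sum_list (map snd xs)"
  using assms
proof (induction xs rule: rev_induct)
  case (snoc kc xs)
  then show ?case
    by (cases kc) (fastforce simp: ogs_gen_power_apply)
qed simp

text \<open>After the letters before the last one, the points above \<open>M\<close> are in their original order and lie above the
  last exponent \<open>c\<close>, because the point at the sum of all exponents has itself come down to \<open>c\<close>. Above \<open>c\<close>
  the last letter is increasing.\<close>
lemma elementary_word_mono:
  assumes "\<And>k i. (k, i) \<in> set xs \<Longrightarrow> H \<le> k"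
    and "sum_list (map snd xs) \<le> H"
    and "sum_list (map snd xs) < x" "x < y"
  shows "ogs_prod xs x < ogs_prod xs y"
  using assms
proof (induction xs arbitrary: x y rule: rev_induct)
  case (snoc kc xs)
  obtain k c where kc: "kc = (k, c)" by force
  define M where "M = sum_list (map snd xs)"
  have "k \<ge> H" and H: "M + c \<le> H" "M + c < x"
    using snoc.prems by (auto simp: M_def kc)
  have IH: "ogs_prod xs a < ogs_prod xs b" if "M < a" "a < b" for a b
    using snoc.prems(1) H that by (intro snoc.IH) (auto simp: M_def)
  then have xy: "ogs_prod xs x < ogs_prod xs y"
    using snoc.prems H by simp
  have "c < ogs_prod xs x"
  proof (cases "c = 0")
    case True
    have "ogs_prod xs permutes {1..Max (insert 0 (fst ` set xs))}"
      by (rule ogs_prod_permutes) (force intro!: Max_ge)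
    then have "ogs_prod xs x \<noteq> 0"
      using H by (metis permutes_not_in permutes_inverses(2) atLeastAtMost_iff
          not_less_zero not_one_le_zero)
    then show ?thesis using True by simp
  next
    case False
    have "ogs_prod xs (M + c) = c"
      using elementary_word_low[of xs H "M + c"] snoc.prems H False by (auto simp: M_def)
    moreover have "ogs_prod xs (M + c) < ogs_prod xs x"
      using IH H False by simp
    ultimately show ?thesis by simp
  qed
  then show ?case
    using xy \<open>k \<ge> H\<close> H by (auto simp: kc ogs_gen_power_apply)
qed simp

text \<open>The letter with index \<open>j\<close> finds its block at the places \<open>1, \<dots>, i\<^sub>j\<close> and moves it to the top of
  \<open>1, \<dots>, k\<^sub>j\<close>; the later letters move it down by their exponents. Altogether the block is translated by
  \<open>k\<^sub>j\<close> minus the sum of all exponents.\<close>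
lemma elementary_word_block:
  assumes "sorted_wrt (<) (map fst xs)"
    and "\<And>k i. (k, i) \<in> set xs \<Longrightarrow> H \<le> k"
    and "sum_list (map snd xs) \<le> H"
    and "j < length xs"
    and "sum_list (map snd (take j xs)) < x" "x \<le> sum_list (map snd (take (Suc j) xs))"
  shows "ogs_prod xs x = x + (fst (xs ! j) - sum_list (map snd xs))"
  using assms
proof (induction xs rule: rev_induct)
  case (snoc kc xs)
  obtain k c where kc: "kc = (k, c)" by force
  define M where "M = sum_list (map snd xs)"
  have k: "H \<le> k" "M + c \<le> H" and srt: "sorted_wrt (<) (map fst xs)"
    and gt: "\<And>i. i < length xs \<Longrightarrow> fst (xs ! i) < k"
    and ge: "\<And>i. i < length xs \<Longrightarrow> H \<le> fst (xs ! i)"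
    using snoc.prems by (auto simp: kc M_def sorted_wrt_append) (metis nth_mem prod.collapse)
  show ?case
  proof (cases "j < length xs")
    case True
    then have "ogs_prod xs x = x + (fst (xs ! j) - M)"
      using snoc.IH[OF srt] snoc.prems by (auto simp: M_def)
    moreover have "x \<le> M"
    proof -
      have "M = sum_list (map snd (take (Suc j) xs)) + sum_list (map snd (drop (Suc j) xs))"
        unfolding M_def by (metis append_take_drop_id map_append sum_list_append)
      then show ?thesis
        using snoc.prems True by simp
    qed
    ultimately show ?thesis
      using k gt[OF True] ge[OF True] snoc.prems(5) True
      by (auto simp: kc nth_append ogs_gen_power_apply M_def[symmetric])
  next
    case False
    then have j: "j = length xs"
      using snoc.prems by simp
    then have "M < x" "x \<le> M + c"
      using snoc.prems by (auto simp: kc M_def)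
    moreover from this have "ogs_prod xs x = x - M"
      using elementary_word_low[of xs H x] snoc.prems k by (auto simp: M_def)
    ultimately show ?thesis
      using k j by (auto simp: kc ogs_gen_power_apply M_def[symmetric])
  qed
qed simp

section \<open>The exponents of the canonical form\<close>

definition rank_below :: "(nat \<Rightarrow> nat) \<Rightarrow> nat \<Rightarrow> nat \<Rightarrow> nat" where
  "rank_below q k y = card {x \<in> {1..k}. q x \<le> y}"

lemma rank_below_0 [simp]: "rank_below q 0 y = 0"
  by (simp add: rank_below_def)

lemma rank_below_Suc:
  "rank_below q (Suc k) y = rank_below q k y + (if q (Suc k) \<le> y then 1 else 0)"
proof -
  have "{x \<in> {1..Suc k}. q x \<le> y} =
      {x \<in> {1..k}. q x \<le> y} \<union> (if q (Suc k) \<le> y then {Suc k} else {})"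
    by (auto simp: le_Suc_eq)
  then show ?thesis
    by (simp add: rank_below_def card_Un_disjoint)
qed

lemma rank_below_le: "rank_below q k y \<le> k"
proof -
  have "card {x \<in> {1..k}. q x \<le> y} \<le> card {1..k}"
    by (intro card_mono) auto
  then show ?thesis by (simp add: rank_below_def)
qed

lemma rank_below_mono: "y \<le> y' \<Longrightarrow> rank_below q k y \<le> rank_below q k y'"
  unfolding rank_below_def by (intro card_mono) auto

lemma rank_below_less:
  assumes "1 \<le> x" "x \<le> k" "y < q x" "q x \<le> y'"
  shows "rank_below q k y < rank_below q k y'"
  unfolding rank_below_def
proof (intro psubset_card_mono psubsetI)
  have "x \<in> {x \<in> {1..k}. q x \<le> y'}" "x \<notin> {x \<in> {1..k}. q x \<le> y}"
    using assms by auto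
  then show "{x \<in> {1..k}. q x \<le> y} \<noteq> {x \<in> {1..k}. q x \<le> y'}"
    by metis
qed (use assms in auto)

lemma rank_below_pos: "1 \<le> x \<Longrightarrow> x \<le> k \<Longrightarrow> 0 < rank_below q k (q x)"
  unfolding rank_below_def by (subst card_gt_0_iff) auto

text \<open>This is the number of \<open>x < k\<close> for which \<open>q x\<close> lies strictly between \<open>q k\<close> and \<open>q (k + 1)\<close> on the
  cycle of all values, run through upwards from \<open>q k\<close>. The addition comes before the subtraction,
  so that nothing is truncated.\<close>
definition ogs_exponent :: "(nat \<Rightarrow> nat) \<Rightarrow> nat \<Rightarrow> nat" where
  "ogs_exponent q k =
     (if q k < q (k + 1) then 0 else k) + rank_below q k (q (k + 1)) - rank_below q k (q k)"

lemma ogs_exponent_less: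
  assumes "1 \<le> k" "q k \<noteq> q (k + 1)"
  shows "ogs_exponent q k < k"
proof (cases "q k < q (k + 1)")
  case True
  then show ?thesis
    using assms rank_below_le[of q k "q (k + 1)"] rank_below_pos[of k k q]
    by (simp add: ogs_exponent_def)
next
  case False
  then have "rank_below q k (q (k + 1)) < rank_below q k (q k)"
    using assms by (intro rank_below_less[of k]) auto
  then show ?thesis
    using False assms by (simp add: ogs_exponent_def)
qed

text \<open>The product of the first \<open>k\<close> powers arranges \<open>1, \<dots>, k\<close> as \<open>q\<close> does, except that the values are
  counted cyclically from \<open>q (k + 1)\<close> on. In the step to \<open>k + 1\<close>, the exponent is such that the new rotation
  moves the origin of the count from \<open>q (k + 1)\<close> to \<open>q (k + 2)\<close>. The six cases are the relative orders of the
  values of \<open>q\<close> at \<open>x\<close>, \<open>k + 1\<close> and \<open>k + 2\<close>.\<close>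
lemma partial_ogs_product:
  assumes "inj q" "1 \<le> x" "x \<le> k"
  shows "ogs_prod (map (\<lambda>k. (k, ogs_exponent q k)) [1..<Suc k]) x =
    (if q x < q (k + 1) then k else 0) + rank_below q k (q x) - rank_below q k (q (k + 1))"
  using assms(2,3)
proof (induction k)
  case (Suc k)
  define K where "K = Suc k"
  define c where "c = ogs_exponent q K"
  define W where "W = ogs_prod (map (\<lambda>k. (k, ogs_exponent q k)) [1..<K])"
  define N where "N = (\<lambda>i. rank_below q k (q i))"
  have ne: "q i \<noteq> q j" if "i \<noteq> j" for i j
    using assms(1) that by (meson injD)
  have cK: "c < K"
    unfolding c_def using ne[of K "K + 1"] by (intro ogs_exponent_less) (auto simp: K_def)
  have step: "ogs_prod (map (\<lambda>k. (k, ogs_exponent q k)) [1..<Suc K]) x =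
      (if 1 \<le> W x \<and> W x \<le> c then W x + K - c
       else if c < W x \<and> W x \<le> K then W x - c else W x)"
  proof -
    have "[1..<Suc K] = [1..<K] @ [K]"
      by (simp add: K_def)
    then show ?thesis
      using cK by (simp add: W_def c_def[symmetric] ogs_gen_power_apply del: upt_Suc)
  qed
  have rK: "rank_below q K (q i) = N i + (if q K \<le> q i then 1 else 0)" for i
    by (simp add: rank_below_Suc K_def N_def)
  have c: "c = (if q K < q (K + 1) then 0 else K) +
      (N (K + 1) + (if q K < q (K + 1) then 1 else 0)) - (N K + 1)"
    unfolding c_def ogs_exponent_def rK using ne[of K "K + 1"] by auto
  have N_le: "N i \<le> k" for i
    by (simp add: N_def rank_below_le)
  have N_mono: "N i \<le> N j" if "q i < q j" for i j
    using that by (simp add: N_def rank_below_mono)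
  have "K = k + 1" by (simp add: K_def)
  show ?case
  proof (cases "x = K")
    case True
    have "W permutes {1..k}"
      unfolding W_def by (intro ogs_prod_permutes) (auto simp: K_def)
    then have "W x = K"
      using True by (simp add: K_def permutes_not_in)
    then have eq: "ogs_prod (map (\<lambda>k. (k, ogs_exponent q k)) [1..<Suc K]) x = K - c"
      unfolding step using cK by simp
    show ?thesis
      unfolding K_def[symmetric] eq
      unfolding True rK c
      using N_le[of K] N_le[of "K + 1"] N_mono[of K "K + 1"] N_mono[of "K + 1" K]
        ne[of K "K + 1"] \<open>K = k + 1\<close>
      by auto
  next
    case False
    then have x: "1 \<le> x" "x \<le> k"
      using Suc.prems by (auto simp: K_def)
    have Wx: "W x = (if q x < q K then k else 0) + N x - N K"
      using Suc.IH[OF x] by (simp add: W_def K_def N_def)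
    have N_less: "N i < N x" if "q i < q x" for i
      unfolding N_def using that x by (intro rank_below_less[of x]) auto
    have N_pos: "0 < N x"
      unfolding N_def using x by (rule rank_below_pos)
    note Kk = \<open>K = k + 1\<close>
    note facts = N_pos N_le[of x] N_le[of K] N_le[of "K + 1"]
    have dist: "q x \<noteq> q K" "q x \<noteq> q (K + 1)" "q K \<noteq> q (K + 1)"
      using x by (intro ne; simp add: Kk)+
    consider "q x < q K" "q K < q (K + 1)" | "q x < q (K + 1)" "q (K + 1) < q K"
      | "q (K + 1) < q x" "q x < q K" | "q K < q x" "q x < q (K + 1)"
      | "q K < q (K + 1)" "q (K + 1) < q x" | "q (K + 1) < q K" "q K < q x"
      using dist by linarith
    then show ?thesis
    proof cases
      case 1
      then show ?thesis
        unfolding K_def[symmetric] step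
        unfolding Wx rK c
        using facts Kk[symmetric] N_mono[of x K] N_mono[of K "K + 1"] by auto
    next
      case 2
      then show ?thesis
        unfolding K_def[symmetric] step
        unfolding Wx rK c
        using facts Kk[symmetric] N_mono[of x "K + 1"] N_mono[of "K + 1" K] by auto
    next
      case 3
      then show ?thesis
        unfolding K_def[symmetric] step
        unfolding Wx rK c
        using facts Kk[symmetric] N_less[of "K + 1"] N_mono[of x K] by auto
    next
      case 4
      then show ?thesis
        unfolding K_def[symmetric] step
        unfolding Wx rK c
        using facts Kk[symmetric] N_less[of K] N_mono[of x "K + 1"] by auto
    next
      case 5
      then show ?thesis
        unfolding K_def[symmetric] step
        unfolding Wx rK c
        using facts Kk[symmetric] N_less[of "K + 1"] N_mono[of K "K + 1"] by auto
    next
      case 6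
      then show ?thesis
        unfolding K_def[symmetric] step
        unfolding Wx rK c
        using facts Kk[symmetric] N_less[of K] N_mono[of "K + 1" K] by auto
    qed
  qed
qed simp

lemma rank_below_permutes:
  assumes "q permutes {1..n}" "y \<le> n"
  shows "rank_below q n y = y"
proof -
  have "{x \<in> {1..n}. q x \<le> y} = inv q ` {1..y}"
  proof (intro equalityI subsetI)
    fix x
    assume "x \<in> {x \<in> {1..n}. q x \<le> y}"
    then have "q x \<in> {1..y}" "x = inv q (q x)"
      using permutes_in_image[OF assms(1), of x] permutes_inverses[OF assms(1)] by auto
    then show "x \<in> inv q ` {1..y}" by blast
  next
    fix x
    assume "x \<in> inv q ` {1..y}"
    then obtain z where z: "z \<in> {1..y}" "x = inv q z" by auto
    then show "x \<in> {x \<in> {1..n}. q x \<le> y}"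
      using assms permutes_in_image[OF permutes_inv[OF assms(1)], of z]
        permutes_inverses[OF assms(1)] by auto
  qed
  moreover have "inj (inv q)"
    using permutes_inj[OF permutes_inv[OF assms(1)]] .
  ultimately show ?thesis
    by (simp add: rank_below_def card_image inj_on_subset)
qed

lemma rank_below_permutes_top:
  assumes "q permutes {1..n}" "n \<le> y"
  shows "rank_below q n y = n"
  using rank_below_permutes[OF assms(1), of n] rank_below_mono[OF assms(2), of q n]
    rank_below_le[of q n y] by simp

text \<open>For \<open>k = n\<close> the count starts from \<open>q (n + 1) = n + 1\<close>, above all values in question, so the cyclic count
  of \<open>q x\<close> is \<open>q x\<close> itself.\<close>
theorem ogs_prod_ogs_exponents:
  assumes "q permutes {1..n}"
  shows "ogs_prod (map (\<lambda>k. (k, ogs_exponent q k)) [1..<Suc n]) = q" (is "?W = q")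
proof
  fix x
  have out: "q (Suc n) = Suc n"
    using assms by (simp add: permutes_not_in)
  show "?W x = q x"
  proof (cases "x \<in> {1..n}")
    case True
    then have "q x \<in> {1..n}"
      using permutes_in_image[OF assms] by blast
    moreover have "rank_below q n (Suc n) = n"
      by (rule rank_below_permutes_top[OF assms]) simp
    ultimately show ?thesis
      using True out
      by (subst partial_ogs_product)
        (auto simp: permutes_inj[OF assms] rank_below_permutes[OF assms])
  next
    case False
    have "?W permutes {1..n}"
      by (rule ogs_prod_permutes) auto
    then show ?thesis
      using assms False by (simp add: permutes_not_in)
  qed
qed

lemma ogs_prod_filter:
  "ogs_prod (filter (\<lambda>(k, i). i \<noteq> 0) xs) = ogs_prod xs"
proof
  show "ogs_prod (filter (\<lambda>(k, i). i \<noteq> 0) xs) x = ogs_prod xs x" for x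
    by (induction xs arbitrary: x) auto
qed

lemma ogs_exponent_permutes_less:
  assumes "q permutes {1..n}" "1 \<le> k"
  shows "ogs_exponent q k < k"
  using assms(2) injD[OF permutes_inj[OF assms(1)], of k "k + 1"]
  by (intro ogs_exponent_less) auto

theorem ogs_canonical_form:
  assumes "q permutes {1..n}" "S \<subseteq> {1..n}"
    and "\<And>k. k \<in> {1..n} - S \<Longrightarrow> ogs_exponent q k = 0"
  defines "xs \<equiv> filter (\<lambda>(k, i). i \<noteq> 0) (map (\<lambda>k. (k, ogs_exponent q k)) (sorted_list_of_set S))"
  shows "ogs_canonical n xs" "ogs_prod xs = q"
proof -
  have fin: "finite S"
    using assms(2) finite_subset by blast
  have flt: "filter (\<lambda>(k, i). i \<noteq> 0) (map (\<lambda>k. (k, ogs_exponent q k)) ks) =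
      map (\<lambda>k. (k, ogs_exponent q k)) (filter (\<lambda>k. ogs_exponent q k \<noteq> 0) ks)" for ks
    by (simp add: filter_map comp_def)
  have "filter (\<lambda>k. ogs_exponent q k \<noteq> 0) (sorted_list_of_set S) =
      filter (\<lambda>k. ogs_exponent q k \<noteq> 0) [1..<Suc n]"
  proof (rule sorted_distinct_set_unique)
    show "set (filter (\<lambda>k. ogs_exponent q k \<noteq> 0) (sorted_list_of_set S)) =
      set (filter (\<lambda>k. ogs_exponent q k \<noteq> 0) [1..<Suc n])"
    proof -
      have "k \<in> S \<longleftrightarrow> k \<in> {1..n}" if "ogs_exponent q k \<noteq> 0" for k
      proof
        show "k \<in> {1..n} \<Longrightarrow> k \<in> S"
          using assms(3)[of k] that by (metis DiffI)
      qed (use assms(2) in \<open>rule subsetD\<close>)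
      then show ?thesis
        using fin by (auto simp del: upt_Suc simp: less_Suc_eq_le)
    qed
  qed (auto simp del: upt_Suc simp: sorted_wrt_filter)
  then have xs: "xs = filter (\<lambda>(k, i). i \<noteq> 0) (map (\<lambda>k. (k, ogs_exponent q k)) [1..<Suc n])"
    by (simp only: xs_def flt)
  then show "ogs_prod xs = q"
    using ogs_prod_ogs_exponents[OF assms(1)] by (simp only: ogs_prod_filter)
  have "sorted_wrt (<) (map fst xs)"
    unfolding xs flt by (simp del: upt_Suc add: comp_def sorted_wrt_filter)
  moreover have "2 \<le> k \<and> k \<le> n \<and> 0 < i \<and> i < k" if "(k, i) \<in> set xs" for k i
  proof -
    have k: "1 \<le> k" "k \<le> n" "i = ogs_exponent q k" "i \<noteq> 0"
      using that by (auto simp: xs)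
    then show ?thesis
      using ogs_exponent_permutes_less[OF assms(1) k(1)] by linarith
  qed
  ultimately show "ogs_canonical n xs"
    by (auto simp: ogs_canonical_def)
qed

text \<open>The theorem of Adin and Roichman that \<open>maj\<close> is the sum of the exponents. The exponents telescope: apart from
  the summand \<open>k\<close> at a descent, the one at \<open>k\<close> is the rank of \<open>q (k + 1)\<close> among the first \<open>k\<close> values minus the
  rank of \<open>q k\<close> among the first \<open>k - 1\<close> values, minus one for \<open>q k\<close> itself.\<close>
lemma sum_ogs_exponent:
  assumes "q permutes {1..n}"
  shows "(\<Sum>k = 1..n. ogs_exponent q k) = maj n q"
proof -
  have ne: "q i \<noteq> q j" if "i \<noteq> j" for i j
    using permutes_inj[OF assms] that by (meson injD)
  have "(\<Sum>k = 1..m. ogs_exponent q k) + m =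
      rank_below q m (q (m + 1)) + (\<Sum>k = 1..m. if q k < q (k + 1) then 0 else k)" for m
  proof (induction m)
    case (Suc m)
    have "ogs_exponent q (Suc m) + rank_below q (Suc m) (q (Suc m)) =
      (if q (Suc m) < q (Suc m + 1) then 0 else Suc m) + rank_below q (Suc m) (q (Suc m + 1))"
      using rank_below_mono[of "q (Suc m)" "q (Suc m + 1)" q "Suc m"]
        rank_below_le[of q "Suc m" "q (Suc m)"]
      by (auto simp: ogs_exponent_def)
    moreover have "rank_below q (Suc m) (q (Suc m)) = rank_below q m (q (m + 1)) + 1"
      by (simp add: rank_below_Suc)
    ultimately show ?case
      using Suc.IH by simp
  qed simp
  from this[of n] have "(\<Sum>k = 1..n. ogs_exponent q k) + n =
      rank_below q n (q (n + 1)) + (\<Sum>k = 1..n. if q k < q (k + 1) then 0 else k)" .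
  moreover have "q (n + 1) = n + 1"
    using assms by (simp add: permutes_not_in)
  moreover have "rank_below q n (n + 1) = n"
    by (rule rank_below_permutes_top[OF assms]) simp
  moreover have "(\<Sum>k = 1..n. if q k < q (k + 1) then 0 else k) = maj n q"
  proof -
    have "q n < q (n + 1)" if "1 \<le> n"
      using that permutes_in_image[OF assms, of n] \<open>q (n + 1) = n + 1\<close> by auto
    then have "des n q = {k \<in> {1..n}. \<not> q k < q (k + 1)}"
    proof -
      have "k \<in> des n q \<longleftrightarrow> k \<in> {k \<in> {1..n}. \<not> q k < q (k + 1)}" for k
        using ne[of k "k + 1"] \<open>1 \<le> n \<Longrightarrow> q n < q (n + 1)\<close>
        by (cases "k = n") (auto simp: des_def not_less le_less)
      then show ?thesis by blast
    qed
    then have "maj n q = (\<Sum>k\<in>{k \<in> {1..n}. \<not> q k < q (k + 1)}. k)"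
      by (simp add: maj_def)
    also have "\<dots> = (\<Sum>k = 1..n. if \<not> q k < q (k + 1) then k else 0)"
      by (simp add: sum.inter_filter[symmetric])
    also have "\<dots> = (\<Sum>k = 1..n. if q k < q (k + 1) then 0 else k)"
      by (intro sum.cong) auto
    finally show ?thesis ..
  qed
  ultimately show ?thesis by simp
qed

section \<open>Elementary elements\<close>

lemma prefix_sum_block:
  fixes ns :: "nat list"
  assumes "0 < x" "x \<le> sum_list ns"
  shows "\<exists>j < length ns. sum_list (take j ns) < x \<and> x \<le> sum_list (take (Suc j) ns)"
  using assms
proof (induction ns rule: rev_induct)
  case (snoc a ns)
  show ?case
  proof (cases "x \<le> sum_list ns")
    case True
    then obtain j where "j < length ns" "sum_list (take j ns) < x" "x \<le> sum_list (take (Suc j) ns)"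
      using snoc by blast
    then show ?thesis
      by (intro exI[of _ j]) auto
  next
    case False
    then show ?thesis
      using snoc.prems by (intro exI[of _ "length ns"]) auto
  qed
qed simp

lemma prefix_sum_mono:
  fixes ns :: "nat list"
  assumes "i \<le> j"
  shows "sum_list (take i ns) \<le> sum_list (take j ns)"
proof -
  have "take j ns = take i ns @ take (j - i) (drop i ns)"
    using assms by (metis le_add_diff_inverse take_add)
  then show ?thesis by simp
qed

lemma ogs_elementaryD:
  assumes "ogs_elementary n xs"
  shows "sorted_wrt (<) (map fst xs)" "xs \<noteq> []" "sum_list (map snd xs) \<le> fst (hd xs)"
    and "\<And>k i. (k, i) \<in> set xs \<Longrightarrow> fst (hd xs) \<le> k \<and> k \<le> fst (last xs) \<and> k \<le> n \<and> 0 < i \<and> i < k"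
proof -
  show srt: "sorted_wrt (<) (map fst xs)" and ne: "xs \<noteq> []"
    and "sum_list (map snd xs) \<le> fst (hd xs)"
    using assms by (auto simp: ogs_elementary_def ogs_canonical_def)
  fix k i
  assume ki: "(k, i) \<in> set xs"
  then obtain j where j: "j < length xs" "xs ! j = (k, i)"
    by (metis in_set_conv_nth)
  have "fst (xs ! a) \<le> fst (xs ! b)" if "a \<le> b" "b < length xs" for a b
    using srt that by (cases "a = b") (auto simp: sorted_wrt_iff_nth_less less_imp_le)
  from this[of 0 j] this[of j "length xs - 1"] have "fst (hd xs) \<le> k" "k \<le> fst (last xs)"
    using j ne by (auto simp: hd_conv_nth last_conv_nth)
  then show "fst (hd xs) \<le> k \<and> k \<le> fst (last xs) \<and> k \<le> n \<and> 0 < i \<and> i < k"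
    using assms ki by (auto simp: ogs_elementary_def ogs_canonical_def)
qed

lemma sum_less_last:
  assumes "ogs_elementary n xs"
  shows "sum_list (map snd xs) < fst (last xs)"
proof (cases "length xs = 1")
  case True
  then obtain k i where "xs = [(k, i)]"
    by (cases xs) auto
  then show ?thesis
    using ogs_elementaryD(4)[OF assms, of k i] by simp
next
  case False
  then have "length xs > 1"
    using ogs_elementaryD(2)[OF assms] by (cases xs) auto
  then have "fst (xs ! 0) < fst (xs ! (length xs - 1))"
    using ogs_elementaryD(1)[OF assms] by (auto simp: sorted_wrt_iff_nth_less)
  then show ?thesis
    using ogs_elementaryD(2,3)[OF assms] by (simp add: hd_conv_nth last_conv_nth)
qed

lemma elementary_permutes:
  assumes "ogs_elementary n xs"
  shows "ogs_prod xs permutes {1..fst (last xs)}"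
  using ogs_elementaryD(4)[OF assms] by (intro ogs_prod_permutes) blast

lemma elementary_block:
  assumes "ogs_elementary n xs" "j < length xs"
    and "sum_list (map snd (take j xs)) < x" "x \<le> sum_list (map snd (take (Suc j) xs))"
  shows "ogs_prod xs x = x + (fst (xs ! j) - sum_list (map snd xs))"
  using ogs_elementaryD[OF assms(1)] assms(2-)
  by (intro elementary_word_block[of _ "fst (hd xs)"]) blast+

lemma elementary_mono_low:
  assumes "ogs_elementary n xs" "1 \<le> x" "x < y" "y \<le> sum_list (map snd xs)"
  shows "ogs_prod xs x < ogs_prod xs y"
proof -
  obtain i where i: "i < length xs" "sum_list (map snd (take i xs)) < x"
      "x \<le> sum_list (map snd (take (Suc i) xs))"
    using prefix_sum_block[of x "map snd xs"] assms by (auto simp: take_map)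
  obtain j where j: "j < length xs" "sum_list (map snd (take j xs)) < y"
      "y \<le> sum_list (map snd (take (Suc j) xs))"
    using prefix_sum_block[of y "map snd xs"] assms by (auto simp: take_map)
  have "i \<le> j"
  proof (rule ccontr)
    assume "\<not> i \<le> j"
    then show False
      using prefix_sum_mono[of "Suc j" i "map snd xs"] i j assms by (simp add: take_map)
  qed
  then have "fst (xs ! i) \<le> fst (xs ! j)"
    using ogs_elementaryD(1)[OF assms(1)] j
    by (cases "i = j") (auto simp: sorted_wrt_iff_nth_less less_imp_le)
  then show ?thesis
    using elementary_block[OF assms(1) i] elementary_block[OF assms(1) j] assms(3) by simp
qed

lemma elementary_mono_high:
  assumes "ogs_elementary n xs" "sum_list (map snd xs) < x" "x < y"
  shows "ogs_prod xs x < ogs_prod xs y"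
  using ogs_elementaryD[OF assms(1)] assms(2-)
  by (intro elementary_word_mono[of _ "fst (hd xs)"]) blast+

text \<open>The product is increasing on either side of \<open>M\<close>. At \<open>M\<close> its value is the last
  index, which exceeds \<open>M\<close> and is the largest of the permuted points. The point \<open>M + 1\<close> is still one of
  these, so the next value is smaller.\<close>
lemma des_elementary:
  assumes "ogs_elementary n xs"
  shows "des n (ogs_prod xs) = {sum_list (map snd xs)}"
proof -
  define M where "M = sum_list (map snd xs)"
  define h where "h = fst (last xs)"
  obtain l where l: "length xs = Suc l"
    using ogs_elementaryD(2)[OF assms] by (cases xs) auto
  have last: "last xs = xs ! l" "last xs \<in> set xs"
    using ogs_elementaryD(2)[OF assms] l by (auto simp: last_conv_nth)
  then have hn: "h \<le> n" and i: "0 < snd (last xs)"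
    using ogs_elementaryD(4)[OF assms, of "fst (last xs)" "snd (last xs)"] by (auto simp: h_def)
  have Mh: "M < h"
    using sum_less_last[OF assms] by (simp add: M_def h_def)
  have "xs = take l xs @ [last xs]"
    using append_butlast_last_id[OF ogs_elementaryD(2)[OF assms]] l by (simp add: butlast_conv_take)
  then have "M = sum_list (map snd (take l xs @ [last xs]))"
    unfolding M_def by (rule arg_cong)
  then have M: "M = sum_list (map snd (take l xs)) + snd (last xs)"
    by simp
  have "ogs_prod xs M = M + (h - M)"
    using elementary_block[OF assms, of l M] l i M last by (simp add: M_def h_def)
  then have sM: "ogs_prod xs M = h"
    using Mh by simp
  have perm: "ogs_prod xs permutes {1..h}"
    unfolding h_def by (rule elementary_permutes[OF assms])
  have "ogs_prod xs (M + 1) \<in> {1..h}"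
    using Mh permutes_in_image[OF perm, of "M + 1"] by simp
  moreover have "ogs_prod xs (M + 1) \<noteq> ogs_prod xs M"
    using permutes_inj[OF perm] by (metis Suc_eq_plus1 injD n_not_Suc_n)
  ultimately have desM: "ogs_prod xs (M + 1) < ogs_prod xs M"
    using sM by simp
  have "x \<in> des n (ogs_prod xs) \<longleftrightarrow> x = M" for x
  proof (cases "x = M")
    case True
    then show ?thesis
      using desM Mh hn M i by (simp add: des_def)
  next
    case False
    then consider "x = 0" | "1 \<le> x" "x < M" | "M < x"
      by linarith
    then show ?thesis
      using False elementary_mono_low[OF assms, of x "x + 1"]
        elementary_mono_high[OF assms, of x "x + 1"]
      by cases (auto simp: des_def M_def)
  qed
  then show ?thesis
    by (auto simp: M_def)
qed

lemma maj_elementary: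
  assumes "ogs_elementary n xs"
  shows "maj n (ogs_prod xs) = sum_list (map snd xs)"
  by (simp add: maj_def des_elementary[OF assms])

text \<open>A version without \<open>maj\<close>. The bounds by the first index of a factor are part of being elementary,
  so only the bounds that link consecutive factors remain.\<close>
lemma ogs_elementary_presentation_iff:
  "ogs_elementary_presentation n p F \<longleftrightarrow>
     p = pprod (map ogs_prod F) \<and> (\<forall>xs\<in>set F. ogs_elementary n xs) \<and>
     (\<forall>v. 1 \<le> v \<and> v < length F \<longrightarrow> fst (last (F ! (v - 1))) \<le> sum_list (map snd (F ! v)))"
proof (cases "\<forall>xs\<in>set F. ogs_elementary n xs")
  case True
  then have el: "ogs_elementary n (F ! (v - 1))" if "1 \<le> v" "v \<le> length F" for v
    using that by auto
  have majF: "fac_maj n F v = sum_list (map snd (F ! (v - 1)))" if "1 \<le> v" "v \<le> length F" for v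
    using maj_elementary[OF el[OF that]] by (simp add: fac_maj_def)
  have hF: "fac_maj n F v \<le> fac_h F v 1" if "1 \<le> v" "v \<le> length F" for v
    using majF[OF that] ogs_elementaryD(2,3)[OF el[OF that]] by (simp add: fac_h_def hd_conv_nth)
  have lastF: "fac_h F v (fac_m F v) = fst (last (F ! (v - 1)))" if "1 \<le> v" "v \<le> length F" for v
    using ogs_elementaryD(2)[OF el[OF that]] by (simp add: fac_h_def fac_m_def last_conv_nth)
  have "(\<forall>v\<in>{2..length F}. fac_h F (v - 1) (fac_m F (v - 1)) \<le> fac_maj n F v \<and>
      fac_maj n F v \<le> fac_h F v 1) \<longleftrightarrow>
    (\<forall>v. 1 \<le> v \<and> v < length F \<longrightarrow> fst (last (F ! (v - 1))) \<le> sum_list (map snd (F ! v)))"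
    (is "?L \<longleftrightarrow> ?R")
  proof
    assume ?L
    show ?R
    proof (intro allI impI)
      fix v
      assume v: "1 \<le> v \<and> v < length F"
      then have "fac_h F v (fac_m F v) \<le> fac_maj n F (Suc v)"
        using \<open>?L\<close>[rule_format, of "Suc v"] by simp
      then show "fst (last (F ! (v - 1))) \<le> sum_list (map snd (F ! v))"
        using v majF[of "Suc v"] lastF[of v] by simp
    qed
  next
    assume ?R
    show ?L
    proof (intro ballI conjI)
      fix v
      assume v: "v \<in> {2..length F}"
      then show "fac_maj n F v \<le> fac_h F v 1"
        by (intro hF) auto
      obtain u where "v = Suc u" "1 \<le> u" "u < length F"
        using v by (cases v) auto
      then show "fac_h F (v - 1) (fac_m F (v - 1)) \<le> fac_maj n F v"
        using \<open>?R\<close>[rule_format, of u] majF[of v] lastF[of u] by simp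
    qed
  qed
  moreover have "F \<noteq> [] \<Longrightarrow> fac_maj n F 1 \<le> fac_h F 1 1"
    using hF[of 1] by (cases F) auto
  ultimately show ?thesis
    using True by (auto simp only: ogs_elementary_presentation_def)
next
  case False
  then show ?thesis
    by (auto simp only: ogs_elementary_presentation_def)
qed

lemma rho_eq_prefix_sum:
  assumes "j \<le> fac_m F v"
  shows "rho F v j = sum_list (map snd (take j (F ! (v - 1))))"
  using assms
proof (induction j)
  case (Suc j)
  then show ?case
    by (simp add: rho_def fac_i_def fac_m_def take_Suc_conv_app_nth)
qed (simp add: rho_def)

section \<open>The factors of a presentation\<close>

locale elementary_factors =
  fixes n :: nat and p :: "nat \<Rightarrow> nat" and F :: "ogs_word list"
  assumes presentation: "ogs_elementary_presentation n p F"
begin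

abbreviation z :: nat where "z \<equiv> length F"
abbreviation m :: "nat \<Rightarrow> nat" where "m \<equiv> fac_m F"
abbreviation \<rho> :: "nat \<Rightarrow> nat \<Rightarrow> nat" where "\<rho> \<equiv> rho F"
abbreviation \<theta> :: "nat \<Rightarrow> nat \<Rightarrow> nat" where "\<theta> \<equiv> theta n F"
abbreviation M :: "nat \<Rightarrow> nat" where "M v \<equiv> \<rho> v (m v)"

definition factor :: "nat \<Rightarrow> nat \<Rightarrow> nat" where
  "factor v = ogs_prod (F ! (v - 1))"

text \<open>The last position of the \<open>v\<close>-th run. The last run, with index \<open>z + 1\<close>, is extended to \<open>n + 1\<close>, so that the
  value \<open>k + 1\<close> has a run also for \<open>k = n\<close>.\<close>
definition bound :: "nat \<Rightarrow> nat" where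
  "bound v = (if v = 0 then 0 else if v \<le> z then M v else n + 1)"

lemma elementary: "1 \<le> v \<Longrightarrow> v \<le> z \<Longrightarrow> ogs_elementary n (F ! (v - 1))"
  using presentation by (auto simp: ogs_elementary_presentation_iff)

lemma M_eq: "M v = sum_list (map snd (F ! (v - 1)))"
  by (simp add: rho_eq_prefix_sum fac_m_def)

lemma fac_maj_eq: "1 \<le> v \<Longrightarrow> v \<le> z \<Longrightarrow> fac_maj n F v = M v"
  using maj_elementary[OF elementary] by (simp add: fac_maj_def M_eq)

lemma theta_eq: "1 \<le> v \<Longrightarrow> v \<le> z \<Longrightarrow> \<theta> v j = fac_h F v j - M v"
  by (simp add: theta_def fac_maj_eq)

lemma m_pos: "1 \<le> v \<Longrightarrow> v \<le> z \<Longrightarrow> 1 \<le> m v"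
  using ogs_elementaryD(2)[OF elementary, of v] by (simp add: fac_m_def Suc_le_eq)

lemma rho_0 [simp]: "\<rho> v 0 = 0"
  by (simp add: rho_def)

lemma rho_less:
  assumes v: "1 \<le> v" "v \<le> z" and j: "1 \<le> j" "j \<le> m v"
  shows "\<rho> v (j - 1) < \<rho> v j"
proof -
  have "F ! (v - 1) ! (j - 1) \<in> set (F ! (v - 1))"
    using j by (auto simp: fac_m_def)
  then have "0 < fac_i F v j"
    unfolding fac_i_def
    using ogs_elementaryD(4)[OF elementary[OF v], of "fst (F ! (v - 1) ! (j - 1))"
        "snd (F ! (v - 1) ! (j - 1))"] by simp
  moreover have "\<rho> v j = \<rho> v (j - 1) + fac_i F v j"
    using j by (cases j) (auto simp: rho_def)
  ultimately show ?thesis by simp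
qed

lemma rho_mono: "i \<le> j \<Longrightarrow> \<rho> v i \<le> \<rho> v j"
  unfolding rho_def by (intro sum_mono2) auto

lemma theta_less:
  assumes v: "1 \<le> v" "v \<le> z" and "1 \<le> i" "i < j" "j \<le> m v"
  shows "\<theta> v i < \<theta> v j"
proof -
  have i: "F ! (v - 1) ! (i - 1) \<in> set (F ! (v - 1))"
    using assms by (auto simp: fac_m_def)
  then have "M v \<le> fac_h F v i"
    unfolding M_eq fac_h_def using ogs_elementaryD(3)[OF elementary[OF v]]
      ogs_elementaryD(4)[OF elementary[OF v], of "fst (F ! (v - 1) ! (i - 1))"
        "snd (F ! (v - 1) ! (i - 1))"] by simp
  moreover have "fac_h F v i < fac_h F v j"
    using ogs_elementaryD(1)[OF elementary[OF v]] assms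
    by (auto simp: fac_h_def fac_m_def sorted_wrt_iff_nth_less)
  ultimately show ?thesis
    by (simp add: theta_eq[OF v])
qed

lemma factor_block:
  assumes "1 \<le> v" "v \<le> z" "1 \<le> j" "j \<le> m v" "\<rho> v (j - 1) < y" "y \<le> \<rho> v j"
  shows "factor v y = y + \<theta> v j"
  using elementary_block[OF elementary, of v "j - 1" y] assms
  by (simp add: factor_def theta_eq rho_eq_prefix_sum fac_h_def M_eq) (simp add: fac_m_def)

lemma block_exists:
  assumes "1 \<le> y" "y \<le> M v"
  obtains j where "1 \<le> j" "j \<le> m v" "\<rho> v (j - 1) < y" "y \<le> \<rho> v j"
proof -
  obtain j where "j < m v" "\<rho> v j < y" "y \<le> \<rho> v (Suc j)"
    using prefix_sum_block[of y "map snd (F ! (v - 1))"] assms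
    by (auto simp: rho_eq_prefix_sum fac_m_def take_map)
  then show thesis
    by (intro that[of "Suc j"]) auto
qed

lemma block_unique:
  assumes "\<rho> v (i - 1) < y" "y \<le> \<rho> v i" "\<rho> v (j - 1) < y" "y \<le> \<rho> v j"
  shows "i = j"
proof (rule ccontr)
  assume "i \<noteq> j"
  then consider "i \<le> j - 1" | "j \<le> i - 1" by linarith
  then show False
    using rho_mono[of i "j - 1" v] rho_mono[of j "i - 1" v] assms by cases auto
qed

lemma bound_factor [simp]: "1 \<le> v \<Longrightarrow> v \<le> z \<Longrightarrow> bound v = M v"
  by (simp add: bound_def)

lemma M_theta:
  assumes v: "1 \<le> v" "v \<le> z"
  shows "M v + \<theta> v (m v) = fst (last (F ! (v - 1)))"
proof -
  have "fac_h F v (m v) = fst (last (F ! (v - 1)))"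
    using ogs_elementaryD(2)[OF elementary[OF v]]
    by (simp add: fac_h_def fac_m_def last_conv_nth)
  then show ?thesis
    using sum_less_last[OF elementary[OF v]] theta_eq[OF v] M_eq[of v] by simp
qed

lemma last_le_n: "1 \<le> v \<Longrightarrow> v \<le> z \<Longrightarrow> fst (last (F ! (v - 1))) \<le> n"
  using ogs_elementaryD(2)[OF elementary, of v]
    ogs_elementaryD(4)[OF elementary, of v "fst (last (F ! (v - 1)))" "snd (last (F ! (v - 1)))"]
  by simp

lemma top_le_bound:
  assumes "1 \<le> v" "v \<le> z"
  shows "M v + \<theta> v (m v) \<le> bound (Suc v)"
proof (cases "v < z")
  case True
  then show ?thesis
    using presentation assms M_eq[of "Suc v"]
    by (simp add: M_theta ogs_elementary_presentation_iff)
next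
  case False
  then show ?thesis
    using last_le_n[of v] assms by (simp add: M_theta bound_def)
qed

lemma bound_mono: "u \<le> v \<Longrightarrow> bound u \<le> bound v"
proof (induction v)
  case (Suc v)
  have "bound v \<le> bound (Suc v)"
  proof (cases "1 \<le> v \<and> v \<le> z")
    case True
    then show ?thesis using top_le_bound[of v] by simp
  qed (auto simp: bound_def)
  then show ?case
    using Suc by (cases "u = Suc v") auto
qed (simp add: bound_def)

lemma factor_permutes_top: "1 \<le> v \<Longrightarrow> v \<le> z \<Longrightarrow> factor v permutes {1..M v + \<theta> v (m v)}"
  using elementary_permutes[OF elementary, of v] by (simp add: factor_def M_theta)

lemma factor_permutes:
  assumes "1 \<le> v" "v \<le> z" "M v + \<theta> v (m v) \<le> b"
  shows "factor v permutes {1..b}"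
  using assms(3) by (intro permutes_subset[OF factor_permutes_top[OF assms(1,2)]]) auto

lemma factor_permutes_n: "1 \<le> v \<Longrightarrow> v \<le> z \<Longrightarrow> factor v permutes {1..n}"
  using last_le_n[of v] by (intro factor_permutes) (auto simp: M_theta)

lemma factor_mono_low: "1 \<le> v \<Longrightarrow> v \<le> z \<Longrightarrow> 1 \<le> x \<Longrightarrow> x < y \<Longrightarrow> y \<le> M v \<Longrightarrow> factor v x < factor v y"
  using elementary_mono_low[OF elementary] by (simp add: factor_def M_eq)

lemma factor_mono_high: "1 \<le> v \<Longrightarrow> v \<le> z \<Longrightarrow> M v < x \<Longrightarrow> x < y \<Longrightarrow> factor v x < factor v y"
  using elementary_mono_high[OF elementary] by (simp add: factor_def M_eq)


section \<open>Tail products and runs\<close>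

definition tail_prod :: "nat \<Rightarrow> nat \<Rightarrow> nat" where
  "tail_prod v = pprod (map ogs_prod (drop (v - 1) F))"

text \<open>The place at which the value \<open>x\<close> stands in the tail product.\<close>
definition pos :: "nat \<Rightarrow> nat \<Rightarrow> nat" where
  "pos v x = inv (tail_prod v) x"

lemma tail_prod_last [simp]: "tail_prod (Suc z) x = x"
  by (simp add: tail_prod_def)

lemma tail_prod_step:
  assumes "1 \<le> v" "v \<le> z"
  shows "tail_prod v x = tail_prod (Suc v) (factor v x)"
proof -
  have "drop (v - 1) F = F ! (v - 1) # drop v F"
    using assms Cons_nth_drop_Suc[of "v - 1" F] by simp
  then show ?thesis
    by (simp add: tail_prod_def factor_def)
qed

lemma tail_prod_1: "tail_prod (Suc 0) = p"
  using presentation by (simp add: tail_prod_def ogs_elementary_presentation_def)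

lemma tail_prod_permutes: "tail_prod v permutes {1..n}"
  unfolding tail_prod_def
proof (rule pprod_permutes)
  fix f
  assume "f \<in> set (map ogs_prod (drop (v - 1) F))"
  then obtain xs where "xs \<in> set F" "f = ogs_prod xs"
    using in_set_dropD by fastforce
  moreover from this have "ogs_elementary n xs"
    using presentation by (simp add: ogs_elementary_presentation_iff)
  ultimately show "f permutes {1..n}"
    using ogs_elementaryD(4) by (blast intro: ogs_prod_permutes)
qed

lemma tail_prod_pos [simp]: "tail_prod v (pos v x) = x"
  using permutes_inverses(1)[OF tail_prod_permutes] by (simp add: pos_def)

lemma pos_tail_prod [simp]: "pos v (tail_prod v x) = x"
  using permutes_inverses(2)[OF tail_prod_permutes] by (simp add: pos_def)

lemma pos_1: "pos (Suc 0) = inv p"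
  using tail_prod_1 by (auto simp: pos_def)

lemma pos_ge_1: "1 \<le> x \<Longrightarrow> 1 \<le> pos v x"
  unfolding pos_def by (rule permutes_ge_1[OF permutes_inv[OF tail_prod_permutes]])

lemma pos_step:
  assumes "1 \<le> v" "v \<le> z"
  shows "pos (Suc v) x = factor v (pos v x)"
  using tail_prod_step[OF assms, of "pos v x"] pos_tail_prod[of "Suc v" "factor v (pos v x)"] by simp

lemma factor_eqD:
  assumes "1 \<le> v" "v \<le> z" "factor v x = factor v y"
  shows "x = y"
  using assms(3) permutes_inj[OF factor_permutes_n[OF assms(1,2)]] by (simp add: inj_eq)

lemma factor_range:
  assumes "1 \<le> v" "v \<le> z" "1 \<le> y" "y \<le> M v"
  shows "1 \<le> factor v y" "factor v y \<le> bound (Suc v)"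
proof -
  show "1 \<le> factor v y"
    by (rule permutes_ge_1[OF factor_permutes_top[OF assms(1,2)] assms(3)])
  show "factor v y \<le> bound (Suc v)"
    using permutes_le_iff[OF factor_permutes_top[OF assms(1,2)], of y]
      top_le_bound[OF assms(1,2)] assms(4) by simp
qed

text \<open>Each factor is increasing on the points up to its \<open>M\<close> and maps them to points up to the \<open>M\<close> of the
  next factor, which is therefore increasing on their images.\<close>
lemma tail_prod_mono:
  assumes "1 \<le> v" "v \<le> Suc z" "1 \<le> x" "x < y" "y \<le> bound v"
  shows "tail_prod v x < tail_prod v y"
  using assms(2,1,3-)
proof (induction v arbitrary: x y rule: inc_induct)
  case (step v)
  then have v: "1 \<le> v" "v \<le> z" by auto
  have "factor v x < factor v y"
    using step v by (intro factor_mono_low) auto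
  then show ?case
    using step v factor_range[OF v, of x] factor_range[OF v, of y] by (simp add: tail_prod_step)
qed simp

lemma tail_prod_less_iff:
  assumes "1 \<le> v" "v \<le> Suc z" "1 \<le> x" "x \<le> bound v" "1 \<le> y" "y \<le> bound v"
  shows "tail_prod v x < tail_prod v y \<longleftrightarrow> x < y"
  using tail_prod_mono[OF assms(1,2), of x y] tail_prod_mono[OF assms(1,2), of y x] assms
  by (cases x y rule: linorder_cases) auto

lemma pos_mono:
  assumes "1 \<le> v" "v \<le> Suc z" "1 \<le> x" "x < y" "pos v x \<le> bound v" "pos v y \<le> bound v"
  shows "pos v x < pos v y"
  using tail_prod_less_iff[OF assms(1,2), of "pos v x" "pos v y"] pos_ge_1[of x v] pos_ge_1[of y v] assms
  by simp

text \<open>A place strictly between those of \<open>x\<close> and \<open>x + 1\<close> would carry a value strictly between \<open>x\<close> and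
  \<open>x + 1\<close>.\<close>
lemma pos_consecutive:
  assumes "1 \<le> v" "v \<le> Suc z" "1 \<le> x" "pos v x \<le> bound v" "pos v (x + 1) \<le> bound v"
  shows "pos v (x + 1) = pos v x + 1"
proof (rule ccontr)
  assume "pos v (x + 1) \<noteq> pos v x + 1"
  then have "pos v x + 1 < pos v (x + 1)"
    using pos_mono[OF assms(1-3), of "x + 1"] assms by simp
  then show False
    using tail_prod_mono[OF assms(1,2), of "pos v x" "pos v x + 1"]
      tail_prod_mono[OF assms(1,2), of "pos v x + 1" "pos v (x + 1)"] assms pos_ge_1[of x v] by simp
qed

text \<open>The factors before the \<open>v\<close>-th one permute the positions up to \<open>bound v\<close> among themselves.\<close>
lemma pos_le_bound_iff:
  assumes "1 \<le> v" "v \<le> Suc z"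
  shows "pos v x \<le> bound v \<longleftrightarrow> inv p x \<le> bound v"
proof -
  have "pos u x \<le> bound v \<longleftrightarrow> pos 1 x \<le> bound v" if "1 \<le> u" "u \<le> v" for u
    using that
  proof (induction u rule: dec_induct)
    case (step u)
    then have u: "1 \<le> u" "u \<le> z" using assms by auto
    have perm: "factor u permutes {1..bound v}"
      using top_le_bound[OF u] bound_mono[of "Suc u" v] step by (intro factor_permutes[OF u]) auto
    then show ?case
      using step by (simp add: pos_step[OF u] permutes_le_iff[OF perm])
  qed simp
  from this[of v] show ?thesis
    using assms by (simp add: pos_1)
qed

text \<open>The tail product sorts the values at the positions up to \<open>bound v\<close>, so the place of such a value is its rank
  among them.\<close>
lemma pos_eq_rank:
  assumes "1 \<le> v" "v \<le> Suc z" "inv p x \<le> bound v"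
  shows "pos v x = rank_below (inv p) x (bound v)"
proof -
  have px: "pos v x \<le> bound v"
    using assms by (simp add: pos_le_bound_iff)
  have "{y \<in> {1..x}. inv p y \<le> bound v} = tail_prod v ` {1..pos v x}"
  proof (intro equalityI subsetI)
    fix y
    assume "y \<in> {y \<in> {1..x}. inv p y \<le> bound v}"
    then have y: "1 \<le> y" "y \<le> x" "pos v y \<le> bound v"
      using pos_le_bound_iff[OF assms(1,2)] by auto
    then have "pos v y \<le> pos v x"
      using pos_mono[OF assms(1,2), of y x] px by (cases "y = x") auto
    then show "y \<in> tail_prod v ` {1..pos v x}"
      using y pos_ge_1[of y v] by (intro image_eqI[of _ _ "pos v y"]) auto
  next
    fix y
    assume "y \<in> tail_prod v ` {1..pos v x}"
    then obtain t where t: "y = tail_prod v t" "1 \<le> t" "t \<le> pos v x"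
      by auto
    then have "tail_prod v t \<le> tail_prod v (pos v x)"
      using tail_prod_mono[OF assms(1,2), of t "pos v x"] px by (cases "t = pos v x") auto
    moreover have "1 \<le> tail_prod v t"
      by (rule permutes_ge_1[OF tail_prod_permutes t(2)])
    moreover have "inv p (tail_prod v t) \<le> bound v"
      using pos_le_bound_iff[OF assms(1,2), of "tail_prod v t"] t px by simp
    ultimately show "y \<in> {y \<in> {1..x}. inv p y \<le> bound v}"
      using t by simp
  qed
  moreover have "inj_on (tail_prod v) {1..pos v x}"
    using permutes_inj[OF tail_prod_permutes] by (rule inj_on_subset) simp
  ultimately show ?thesis
    by (simp add: rank_below_def card_image)
qed

text \<open>The factors before the \<open>(v - 1)\<close>-th one fix the positions above \<open>bound (v - 1)\<close>. The next one is
  increasing there and does not lead beyond \<open>bound v\<close>, up to which the remaining tail product is increasing.\<close>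
lemma increasing_on_run:
  assumes v: "1 \<le> v" "v \<le> Suc z" and y: "bound (v - 1) < y" "y < y'" "y' \<le> bound v"
  shows "p y < p y'"
proof (cases "v = 1")
  case True
  then show ?thesis
    using tail_prod_mono[OF v, of y y'] y tail_prod_1 by simp
next
  case False
  define u where "u = v - 1"
  then have u: "1 \<le> u" "u \<le> z" "v = Suc u"
    using False v by auto
  have fixed: "tail_prod w x = tail_prod u x" if "1 \<le> w" "w \<le> u" "bound u < x" for w x
    using that(2,1,3)
  proof (induction w rule: inc_induct)
    case (step w)
    then have w: "1 \<le> w" "w \<le> z" using u by auto
    have "factor w permutes {1..bound u}"
      using top_le_bound[OF w] bound_mono[of "Suc w" u] step by (intro factor_permutes[OF w]) auto
    then have "factor w x = x"
      using step.prems by (simp add: permutes_not_in)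
    then show ?case
      using step w by (simp add: tail_prod_step)
  qed simp
  have "factor u y' \<le> bound v"
    using permutes_le_iff[OF factor_permutes[OF u(1,2) top_le_bound[OF u(1,2)]], of y'] y u by simp
  moreover have "factor u y < factor u y'"
    using u y by (intro factor_mono_high) auto
  moreover have "1 \<le> factor u y"
    using y by (intro permutes_ge_1[OF factor_permutes_n[OF u(1,2)]]) simp
  ultimately have "tail_prod v (factor u y) < tail_prod v (factor u y')"
    using v by (intro tail_prod_mono) auto
  then have "tail_prod u y < tail_prod u y'"
    using u by (simp add: tail_prod_step)
  then show ?thesis
    using fixed[of 1 y] fixed[of 1 y'] u y tail_prod_1 by simp
qed

lemma des_subset_fac_maj: "des n p \<subseteq> fac_maj n F ` {1..z}"
proof
  fix k
  assume "k \<in> des n p"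
  then have k: "1 \<le> k" "k \<le> n - 1" "p (k + 1) < p k"
    by (auto simp: des_def)
  define v where "v = (LEAST v. k \<le> bound v)"
  have ex: "k \<le> bound (Suc z)"
    using k by (simp add: bound_def)
  then have kv: "k \<le> bound v"
    unfolding v_def by (rule LeastI)
  have vz: "v \<le> Suc z"
    unfolding v_def using ex by (rule Least_le)
  have v: "1 \<le> v"
    using kv k by (cases v) (auto simp: bound_def)
  have "bound (v - 1) < k"
    using not_less_Least[of "v - 1" "\<lambda>v. k \<le> bound v"] v by (simp add: v_def)
  then have "\<not> k + 1 \<le> bound v"
    using increasing_on_run[OF v vz, of k "k + 1"] k by auto
  then have "k = bound v"
    using kv by simp
  moreover from this have "v \<le> z"
    using k vz by (cases "v = Suc z") (auto simp: bound_def)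
  ultimately show "k \<in> fac_maj n F ` {1..z}"
    using v by (auto simp: fac_maj_eq)
qed

text \<open>The run of \<open>p\<close> in which the value \<open>x\<close> stands.\<close>
definition run :: "nat \<Rightarrow> nat" where
  "run x = (LEAST v. 1 \<le> v \<and> inv p x \<le> bound v)"

lemma inv_p_permutes: "inv p permutes {1..n}"
  using permutes_inv[OF tail_prod_permutes[of 1]] by (simp add: tail_prod_1)

lemma inv_p_le:
  assumes "x \<le> n + 1"
  shows "inv p x \<le> n + 1"
  using permutes_le_iff[OF inv_p_permutes, of x] permutes_not_in[OF inv_p_permutes, of x] assms
  by (cases "x \<le> n") auto

lemma p_inv_p [simp]: "p (inv p x) = x"
  using tail_prod_pos[of "Suc 0" x] unfolding pos_1 tail_prod_1 .

lemma run_le_iff: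
  assumes "x \<le> n + 1" "1 \<le> v"
  shows "run x \<le> v \<longleftrightarrow> inv p x \<le> bound v"
proof -
  have "1 \<le> Suc z \<and> inv p x \<le> bound (Suc z)"
    using inv_p_le[OF assms(1)] by (simp add: bound_def)
  then have "1 \<le> run x \<and> inv p x \<le> bound (run x)"
    unfolding run_def by (rule LeastI)
  then show ?thesis
    using bound_mono[of "run x" v] assms(2)
    by (auto simp: run_def intro!: Least_le)
qed

lemma run_ge_1: "x \<le> n + 1 \<Longrightarrow> 1 \<le> run x"
  and run_le: "x \<le> n + 1 \<Longrightarrow> run x \<le> Suc z"
proof -
  assume x: "x \<le> n + 1"
  have ex: "1 \<le> Suc z \<and> inv p x \<le> bound (Suc z)"
    using inv_p_le[OF x] by (simp add: bound_def)
  show "1 \<le> run x"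
    unfolding run_def using LeastI[of "\<lambda>v. 1 \<le> v \<and> inv p x \<le> bound v", OF ex] by simp
  show "run x \<le> Suc z"
    unfolding run_def using ex by (rule Least_le)
qed

lemma pos_le_iff_run:
  assumes "x \<le> n + 1" "1 \<le> v" "v \<le> Suc z"
  shows "pos v x \<le> bound v \<longleftrightarrow> run x \<le> v"
  using assms by (simp add: run_le_iff pos_le_bound_iff)

lemma bound_less_run:
  assumes "1 \<le> x" "x \<le> n + 1" "v < run x"
  shows "bound v < inv p x"
proof (cases "v = 0")
  case True
  then show ?thesis
    using permutes_ge_1[OF inv_p_permutes assms(1)] by (simp add: bound_def)
next
  case False
  then show ?thesis
    using run_le_iff[of x v] assms by auto
qed

text \<open>Values that stand after \<open>y\<close> in the run of \<open>y\<close> are larger than \<open>y\<close>, hence larger than \<open>k\<close>.\<close>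
lemma rank_run:
  assumes "1 \<le> k" "k \<le> y" "y \<le> n + 1"
  shows "rank_below (inv p) k (inv p y) = rank_below (inv p) k (bound (run y))"
proof -
  have y: "1 \<le> run y" "run y \<le> Suc z" "inv p y \<le> bound (run y)" "bound (run y - 1) < inv p y"
    using run_ge_1[of y] run_le[of y] run_le_iff[of y "run y"]
      bound_less_run[of y "run y - 1"] assms by auto
  have "inv p x \<le> inv p y \<longleftrightarrow> inv p x \<le> bound (run y)" if "1 \<le> x" "x \<le> k" for x
  proof
    assume "inv p x \<le> bound (run y)"
    then show "inv p x \<le> inv p y"
      using increasing_on_run[OF y(1,2), of "inv p y" "inv p x"] y that assms
      by (cases "inv p x \<le> inv p y") auto
  qed (use y in simp)
  then show ?thesis
    unfolding rank_below_def by (intro arg_cong[where f = card]) auto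
qed

text \<open>The exponent is a difference of ranks. By \<open>rank_run\<close> they can be taken at the ends of the runs of \<open>k\<close> and of
  \<open>k + 1\<close>, and there \<open>pos_eq_rank\<close> turns them into places of \<open>k\<close>.\<close>
lemma exponent_ascent:
  assumes k: "1 \<le> k" "k \<le> n" and r: "run k \<le> run (k + 1)"
  shows "inv p k < inv p (k + 1)"
    and "ogs_exponent (inv p) k + pos (run k) k = pos (run (k + 1)) k"
proof -
  have le: "inv p k \<le> bound (run k)" "inv p (k + 1) \<le> bound (run (k + 1))"
    using k run_ge_1[of k] run_ge_1[of "k + 1"] run_le_iff[of k "run k"]
      run_le_iff[of "k + 1" "run (k + 1)"] by auto
  have neq: "inv p k \<noteq> inv p (k + 1)"
    by (metis n_not_Suc_n p_inv_p Suc_eq_plus1)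
  show asc: "inv p k < inv p (k + 1)"
  proof (cases "run k = run (k + 1)")
    case True
    have "\<not> inv p (k + 1) < inv p k"
      using increasing_on_run[of "run k" "inv p (k + 1)" "inv p k"] True le k
        bound_less_run[of "k + 1" "run k - 1"] run_ge_1[of k] run_le[of k] by auto
    then show ?thesis using neq by simp
  next
    case False
    then show ?thesis
      using bound_less_run[of "k + 1" "run k"] le r k by simp
  qed
  have "bound (run k) \<le> bound (run (k + 1))"
    by (rule bound_mono[OF r])
  then have "pos (run (k + 1)) k = rank_below (inv p) k (bound (run (k + 1)))"
    using le k run_ge_1[of "k + 1"] run_le[of "k + 1"] by (intro pos_eq_rank) auto
  moreover have "pos (run k) k = rank_below (inv p) k (bound (run k))"
    using le k run_ge_1[of k] run_le[of k] by (intro pos_eq_rank) auto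
  moreover have "rank_below (inv p) k (bound (run k)) \<le> rank_below (inv p) k (bound (run (k + 1)))"
    using bound_mono[OF r] by (rule rank_below_mono)
  ultimately show "ogs_exponent (inv p) k + pos (run k) k = pos (run (k + 1)) k"
    using asc k rank_run[of k k] rank_run[of k "k + 1"] by (simp add: ogs_exponent_def)
qed

text \<open>Here \<open>k\<close> has no place in the sorted part of the tail product that starts with the run of \<open>k + 1\<close>. So
  the ranks are expressed by the places of \<open>k + 1\<close>, which are larger by one on both sides.\<close>
lemma exponent_descent:
  assumes k: "1 \<le> k" "k \<le> n" and r: "run (k + 1) < run k"
  shows "inv p (k + 1) < inv p k"
    and "ogs_exponent (inv p) k + pos (run k) (k + 1) = k + pos (run (k + 1)) (k + 1)"
proof -
  have le: "inv p k \<le> bound (run k)" "inv p (k + 1) \<le> bound (run (k + 1))"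
    using k run_ge_1[of k] run_ge_1[of "k + 1"] run_le_iff[of k "run k"]
      run_le_iff[of "k + 1" "run (k + 1)"] by auto
  show desc: "inv p (k + 1) < inv p k"
    using bound_less_run[of k "run (k + 1)"] le r k by simp
  have b: "bound (run (k + 1)) \<le> bound (run k)"
    using r by (intro bound_mono) simp
  then have "pos (run k) (k + 1) = rank_below (inv p) (k + 1) (bound (run k))"
    using le k run_ge_1[of k] run_le[of k] by (intro pos_eq_rank) auto
  then have "pos (run k) (k + 1) = rank_below (inv p) k (bound (run k)) + 1"
    using le b by (simp add: rank_below_Suc)
  moreover have "pos (run (k + 1)) (k + 1) = rank_below (inv p) (k + 1) (bound (run (k + 1)))"
    using le k run_ge_1[of "k + 1"] run_le[of "k + 1"] by (intro pos_eq_rank) auto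
  then have "pos (run (k + 1)) (k + 1) = rank_below (inv p) k (bound (run (k + 1))) + 1"
    using le by (simp add: rank_below_Suc)
  moreover have "rank_below (inv p) k (bound (run k)) \<le> k"
    by (rule rank_below_le)
  ultimately show "ogs_exponent (inv p) k + pos (run k) (k + 1) = k + pos (run (k + 1)) (k + 1)"
    using desc k rank_run[of k k] rank_run[of k "k + 1"] by (simp add: ogs_exponent_def)
qed


section \<open>The numbers \<open>\<kappa>\<close> as images of the ends of blocks\<close>

text \<open>The point \<open>\<kappa>\<^sub>- + 1\<close> is the image of the first point of the block after \<open>d + 1\<close> factors. It does not
  exceed the \<open>M\<close> of the next factor, so it lies in a block of that factor, which is the one that the recursion selects.\<close>
lemma kappa_minus_steps_Suc:
  assumes v: "1 \<le> v" "v + d \<le> z" and j: "1 \<le> j" "j \<le> m v"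
  shows "kappa_minus_steps n F v j d + 1 \<le> bound (Suc (v + d)) \<and>
    tail_prod (Suc (v + d)) (kappa_minus_steps n F v j d + 1) = tail_prod v (\<rho> v (j - 1) + 1)"
  using v(2)
proof (induction d)
  case 0
  have b: "factor v (\<rho> v (j - 1) + 1) = kappa_minus_steps n F v j 0 + 1"
    using factor_block[of v j "\<rho> v (j - 1) + 1"] rho_less[of v j] v j by simp
  have "\<rho> v (j - 1) + 1 \<le> M v"
    using rho_less[of v j] rho_mono[of j "m v" v] v j by simp
  then show ?case
    using factor_range[of v "\<rho> v (j - 1) + 1"] tail_prod_step[of v "\<rho> v (j - 1) + 1"] v b by simp
next
  case (Suc d)
  define u where "u = v + Suc d"
  define a where "a = kappa_minus_steps n F v j d"
  have u: "1 \<le> u" "u \<le> z" and IH: "a + 1 \<le> M u" "tail_prod u (a + 1) = tail_prod v (\<rho> v (j - 1) + 1)"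
    using Suc v by (auto simp: u_def a_def)
  obtain i where i: "1 \<le> i" "i \<le> m u" "\<rho> u (i - 1) < a + 1" "a + 1 \<le> \<rho> u i"
    using block_exists[of "a + 1" u] IH by auto
  have "(THE j'. 1 \<le> j' \<and> j' \<le> m u \<and> \<rho> u (j' - 1) \<le> a \<and> a < \<rho> u j') = i"
  proof (rule the_equality)
    show "j' = i" if "1 \<le> j' \<and> j' \<le> m u \<and> \<rho> u (j' - 1) \<le> a \<and> a < \<rho> u j'" for j'
      using that i by (intro block_unique[of u j' "a + 1" i]) auto
  qed (use i in auto)
  then have "kappa_minus_steps n F v j (Suc d) + 1 = a + 1 + \<theta> u i"
    by (simp add: a_def u_def)
  also have "\<dots> = factor u (a + 1)"
    using factor_block[of u i "a + 1"] u i by simp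
  finally show ?case
    using factor_range[OF u, of "a + 1"] tail_prod_step[OF u, of "a + 1"] IH by (simp add: u_def)
qed

lemma kappa_plus_steps:
  assumes v: "1 \<le> v" "v + d \<le> z" and j: "1 \<le> j" "j \<le> m v"
  shows "1 \<le> kappa_plus_steps n F v j d \<and> kappa_plus_steps n F v j d \<le> bound (Suc (v + d)) \<and>
    tail_prod (Suc (v + d)) (kappa_plus_steps n F v j d) = tail_prod v (\<rho> v j)"
  using v(2)
proof (induction d)
  case 0
  have b: "factor v (\<rho> v j) = kappa_plus_steps n F v j 0"
    using factor_block[of v j "\<rho> v j"] rho_less[of v j] v j by simp
  have "1 \<le> \<rho> v j" "\<rho> v j \<le> M v"
    using rho_less[of v j] rho_mono[of j "m v" v] v j by simp_all
  then show ?case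
    using factor_range[of v "\<rho> v j"] tail_prod_step[of v "\<rho> v j"] v b by simp
next
  case (Suc d)
  define u where "u = v + Suc d"
  define a where "a = kappa_plus_steps n F v j d"
  have u: "1 \<le> u" "u \<le> z" and IH: "1 \<le> a" "a \<le> M u" "tail_prod u a = tail_prod v (\<rho> v j)"
    using Suc v by (auto simp: u_def a_def)
  obtain i where i: "1 \<le> i" "i \<le> m u" "\<rho> u (i - 1) < a" "a \<le> \<rho> u i"
    using block_exists[of a u] IH by auto
  have "(THE j'. 1 \<le> j' \<and> j' \<le> m u \<and> \<rho> u (j' - 1) < a \<and> a \<le> \<rho> u j') = i"
  proof (rule the_equality)
    show "j' = i" if "1 \<le> j' \<and> j' \<le> m u \<and> \<rho> u (j' - 1) < a \<and> a \<le> \<rho> u j'" for j'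
      using that i by (intro block_unique[of u j' a i]) auto
  qed (use i in auto)
  then have "kappa_plus_steps n F v j (Suc d) = a + \<theta> u i"
    by (simp add: a_def u_def)
  also have "\<dots> = factor u a"
    using factor_block[of u i a] u i by simp
  finally show ?case
    using factor_range[OF u, of a] tail_prod_step[OF u, of a] IH by (simp add: u_def)
qed

lemma kappa_minus_eq_tail_prod:
  assumes "1 \<le> v" "v \<le> z" "1 \<le> j" "j \<le> m v"
  shows "kappa_minus n F v j + 1 = tail_prod v (\<rho> v (j - 1) + 1)"
  using kappa_minus_steps_Suc[of v "z - v" j] assms by (simp add: kappa_minus_def)

lemma kappa_plus_eq_tail_prod:
  assumes "1 \<le> v" "v \<le> z" "1 \<le> j" "j \<le> m v"
  shows "kappa_plus n F v j = tail_prod v (\<rho> v j)"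
  using kappa_plus_steps[of v "z - v" j] assms by (simp add: kappa_plus_def)

lemma kappa_plus_eq_iff:
  assumes "1 \<le> v" "v \<le> z" "1 \<le> j" "j \<le> m v"
  shows "kappa_plus n F v j = k \<longleftrightarrow> pos v k = \<rho> v j"
  unfolding kappa_plus_eq_tail_prod[OF assms] using tail_prod_pos[of v k] pos_tail_prod[of v "\<rho> v j"] by metis

lemma kappa_minus_eq_iff:
  assumes "1 \<le> v" "v \<le> z" "1 \<le> j" "j \<le> m v"
  shows "kappa_minus n F v j = k \<longleftrightarrow> pos v (k + 1) = \<rho> v (j - 1) + 1"
proof -
  have "kappa_minus n F v j = k \<longleftrightarrow> tail_prod v (\<rho> v (j - 1) + 1) = k + 1"
    unfolding kappa_minus_eq_tail_prod[OF assms, symmetric] by simp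
  then show ?thesis
    using tail_prod_pos[of v "k + 1"] pos_tail_prod[of v "\<rho> v (j - 1) + 1"] by metis
qed

lemma rho_range:
  assumes "1 \<le> v" "v \<le> z" "1 \<le> j" "j \<le> m v"
  shows "1 \<le> \<rho> v j" "\<rho> v j \<le> M v" "\<rho> v (j - 1) + 1 \<le> M v" "M v \<le> n"
  using rho_less[OF assms] rho_mono[OF assms(4), of v] M_theta[OF assms(1,2)]
    last_le_n[OF assms(1,2)] by linarith+

lemma kappa_plus_range:
  assumes "1 \<le> v" "v \<le> z" "1 \<le> j" "j \<le> m v"
  shows "1 \<le> kappa_plus n F v j" "kappa_plus n F v j \<le> n"
  using kappa_plus_eq_tail_prod[OF assms] rho_range[OF assms] permutes_ge_1[OF tail_prod_permutes, of "\<rho> v j" v]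
    permutes_le_iff[OF tail_prod_permutes, of v "\<rho> v j"] by auto

lemma kappa_minus_less:
  assumes "1 \<le> v" "v \<le> z" "1 \<le> j" "j \<le> m v"
  shows "kappa_minus n F v j < n"
  using kappa_minus_eq_tail_prod[OF assms] rho_range[OF assms]
    permutes_le_iff[OF tail_prod_permutes, of v "\<rho> v (j - 1) + 1"] by auto

lemma image_block_unique:
  assumes u: "1 \<le> u" "u \<le> z" and i: "1 \<le> i" "i \<le> m u" and j: "1 \<le> j" "j \<le> m u"
    and y: "\<rho> u (i - 1) + \<theta> u i < y" "y \<le> \<rho> u i + \<theta> u i"
      "\<rho> u (j - 1) + \<theta> u j < y" "y \<le> \<rho> u j + \<theta> u j"
  shows "i = j"
proof -
  have "factor u (y - \<theta> u i) = y" "factor u (y - \<theta> u j) = y"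
    using factor_block[OF u i, of "y - \<theta> u i"] factor_block[OF u j, of "y - \<theta> u j"] y by auto
  then have "y - \<theta> u i = y - \<theta> u j"
    using factor_eqD[OF u] by metis
  then show ?thesis
    using y by (intro block_unique[of u i "y - \<theta> u i" j]) auto
qed

text \<open>If \<open>k\<close> and \<open>k + 1\<close> both stand among the first \<open>M v\<close> places of a tail product, then their places are adjacent
  there, and again after the \<open>v\<close>-th factor. So that factor translates both by the same amount. Different blocks have
  different translations.\<close>
lemma adjacent_in_one_block:
  assumes v: "1 \<le> v" "v \<le> z" and k: "1 \<le> k"
    and le: "pos v k \<le> M v" "pos v (k + 1) \<le> M v"
    and j: "1 \<le> j" "j \<le> m v" "\<rho> v (j - 1) < pos v k" "pos v k \<le> \<rho> v j"
  shows "\<rho> v (j - 1) + 1 < pos v (k + 1)" "pos v (k + 1) \<le> \<rho> v j"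
proof -
  have con: "pos v (k + 1) = pos v k + 1"
    using le v k by (intro pos_consecutive) auto
  then show "\<rho> v (j - 1) + 1 < pos v (k + 1)"
    using j by simp
  obtain i where i: "1 \<le> i" "i \<le> m v" "\<rho> v (i - 1) < pos v (k + 1)" "pos v (k + 1) \<le> \<rho> v i"
    using block_exists[OF _ le(2)] con by auto
  have ps: "pos (Suc v) k = pos v k + \<theta> v j" "pos (Suc v) (k + 1) = pos v (k + 1) + \<theta> v i"
    using pos_step[OF v] factor_block[OF v j] factor_block[OF v i] by auto
  have "pos (Suc v) (k + 1) = pos (Suc v) k + 1"
    using factor_range[OF v, of "pos v k"] factor_range[OF v, of "pos v (k + 1)"] pos_step[OF v]
      le k v pos_ge_1[of k v] pos_ge_1[of "k + 1" v] by (intro pos_consecutive) auto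
  then have th: "\<theta> v i = \<theta> v j"
    using ps con by simp
  have "i = j"
    using theta_less[OF v, of i j] theta_less[OF v, of j i] th i j by (cases i j rule: linorder_cases) auto
  then show "pos v (k + 1) \<le> \<rho> v j"
    using i by simp
qed

text \<open>If \<open>k\<close> ends a block of the factor \<open>v\<close>, then by \<open>adjacent_in_one_block\<close> the value \<open>k + 1\<close> cannot be among the
  first \<open>M v\<close> entries, so it belongs to a later run.\<close>
lemma kappa_plus_ascent:
  assumes v: "1 \<le> v" "v \<le> z" and j: "1 \<le> j" "j \<le> m v" and k: "1 \<le> k" "k \<le> n"
    and pk: "pos v k = \<rho> v j"
  shows "run k \<le> v" "v < run (k + 1)"
proof -
  note r = rho_range[OF v j]
  then show "run k \<le> v"
    using pos_le_iff_run[of k v] pk v k by simp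
  show "v < run (k + 1)"
  proof (rule ccontr)
    assume "\<not> v < run (k + 1)"
    then have "pos v (k + 1) \<le> M v"
      using pos_le_iff_run[of "k + 1" v] v k by simp
    then show False
      using adjacent_in_one_block[OF v k(1) _ _ j] pk r rho_less[OF v j]
        pos_consecutive[of v k] v k by auto
  qed
qed

lemma kappa_minus_descent:
  assumes v: "1 \<le> v" "v \<le> z" and j: "1 \<le> j" "j \<le> m v" and k: "1 \<le> k" "k \<le> n"
    and pk: "pos v (k + 1) = \<rho> v (j - 1) + 1"
  shows "run (k + 1) \<le> v" "v < run k"
proof -
  note r = rho_range[OF v j]
  then show "run (k + 1) \<le> v"
    using pos_le_iff_run[of "k + 1" v] pk v k by simp
  show "v < run k"
  proof (rule ccontr)
    assume "\<not> v < run k"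
    then have le: "pos v k \<le> M v"
      using pos_le_iff_run[of k v] v k by simp
    obtain i where i: "1 \<le> i" "i \<le> m v" "\<rho> v (i - 1) < pos v k" "pos v k \<le> \<rho> v i"
      using block_exists[OF pos_ge_1[OF k(1)] le] by auto
    have "\<rho> v (i - 1) + 1 < pos v (k + 1)" "pos v (k + 1) \<le> \<rho> v i"
      using adjacent_in_one_block[OF v k(1) le _ i] pk r by auto
    moreover from this have "i = j"
      using pk rho_less[OF v j] by (intro block_unique[of v i "pos v (k + 1)" j]) auto
    ultimately show False
      using pk by simp
  qed
qed

text \<open>The former are ascents and the latter are descents of \<open>inv p\<close>. Hence in the definition of \<open>\<eta>\<close> the weak
  and the strict inequalities between \<open>\<kappa>\<^sub>+\<close> and \<open>\<kappa>\<^sub>-\<close> agree.\<close>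
lemma kappa_plus_neq_kappa_minus:
  assumes "1 \<le> v" "v \<le> z" "1 \<le> j" "j \<le> m v" "1 \<le> u" "u \<le> z" "1 \<le> i" "i \<le> m u"
  shows "kappa_plus n F v j \<noteq> kappa_minus n F u i"
proof
  define k where "k = kappa_plus n F v j"
  assume "kappa_plus n F v j = kappa_minus n F u i"
  then have p: "pos v k = \<rho> v j" "pos u (k + 1) = \<rho> u (i - 1) + 1"
    using kappa_plus_eq_iff[OF assms(1-4), of k] kappa_minus_eq_iff[OF assms(5-8), of k]
    by (auto simp: k_def)
  have k: "1 \<le> k" "k \<le> n"
    using kappa_plus_range[OF assms(1-4)] by (auto simp: k_def)
  show False
    using kappa_plus_ascent[OF assms(1-4) k p(1)] kappa_minus_descent[OF assms(5-8) k p(2)] by simp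
qed

section \<open>The numbers \<open>\<eta>\<close>\<close>

text \<open>A recursive form of \<open>\<eta>\<close>. The gap between the places \<open>y\<close> and \<open>y + 1\<close> is followed back through the factors before
  the \<open>v\<close>-th one as long as it lies inside the image of a block, and the translations of these blocks are added
  up. The same function serves both formulas for the exponents, as a gap after \<open>k\<close> and as a gap
  before \<open>k + 1\<close>.\<close>
primrec carry :: "nat \<Rightarrow> nat \<Rightarrow> nat" where
  "carry 0 y = 0"
| "carry (Suc u) y =
    (if \<exists>j. 1 \<le> u \<and> 1 \<le> j \<and> j \<le> m u \<and> \<rho> u (j - 1) + \<theta> u j < y \<and> y < \<rho> u j + \<theta> u j
     then let j = (SOME j. 1 \<le> j \<and> j \<le> m u \<and> \<rho> u (j - 1) + \<theta> u j < y \<and> y < \<rho> u j + \<theta> u j)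
       in \<theta> u j + carry u (y - \<theta> u j)
     else 0)"

declare carry.simps(2) [simp del]

lemma carry_interior:
  assumes u: "1 \<le> u" "u \<le> z" and j: "1 \<le> j" "j \<le> m u"
    and y: "\<rho> u (j - 1) < y" "y < \<rho> u j"
  shows "carry (Suc u) (y + \<theta> u j) = \<theta> u j + carry u y"
proof -
  define Q where "Q = (\<lambda>j'. 1 \<le> j' \<and> j' \<le> m u \<and> \<rho> u (j' - 1) + \<theta> u j' < y + \<theta> u j \<and>
    y + \<theta> u j < \<rho> u j' + \<theta> u j')"
  have Qj: "Q j"
    using j y by (simp add: Q_def)
  have uniq: "i = j" if "Q i" for i
    using that Qj u j by (intro image_block_unique[of u i j "y + \<theta> u j"]) (auto simp: Q_def)
  have "(SOME j. Q j) = j"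
    using Qj uniq by (rule some_equality)
  moreover have "\<exists>j. 1 \<le> u \<and> Q j"
    using Qj u by auto
  ultimately show ?thesis
    unfolding carry.simps(2) Q_def by simp
qed

lemma carry_exterior:
  assumes "\<And>j. 1 \<le> u \<Longrightarrow> 1 \<le> j \<Longrightarrow> j \<le> m u \<Longrightarrow> \<rho> u (j - 1) + \<theta> u j < y \<Longrightarrow> y < \<rho> u j + \<theta> u j \<Longrightarrow> False"
  shows "carry (Suc u) y = 0"
  unfolding carry.simps(2) using assms by (subst if_not_P) blast+

lemma carry_block_end:
  assumes u: "1 \<le> u" "u \<le> z" and j: "1 \<le> j" "j \<le> m u"
  shows "carry (Suc u) (\<rho> u j + \<theta> u j) = 0"
proof (rule carry_exterior)
  fix i
  assume i: "1 \<le> i" "i \<le> m u" "\<rho> u (i - 1) + \<theta> u i < \<rho> u j + \<theta> u j"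
    "\<rho> u j + \<theta> u j < \<rho> u i + \<theta> u i"
  then have "i = j"
    using u j rho_less[OF u j] by (intro image_block_unique[of u i j "\<rho> u j + \<theta> u j"]) auto
  then show False using i by simp
qed

lemma carry_block_start:
  assumes u: "1 \<le> u" "u \<le> z" and j: "1 \<le> j" "j \<le> m u"
  shows "carry (Suc u) (\<rho> u (j - 1) + \<theta> u j) = 0"
proof (rule carry_exterior)
  fix i
  assume i: "1 \<le> i" "i \<le> m u" "\<rho> u (i - 1) + \<theta> u i < \<rho> u (j - 1) + \<theta> u j"
    "\<rho> u (j - 1) + \<theta> u j < \<rho> u i + \<theta> u i"
  then have "i = j"
    using u j rho_less[OF u j]
    by (intro image_block_unique[of u i j "\<rho> u (j - 1) + \<theta> u j + 1"]) auto
  then show False using i by simp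
qed

text \<open>In the tail product that starts with its own run, \<open>x\<close> lies in no image of a block of the factor
  before: otherwise it would stand in an earlier run. Neither gap next to it is inside such an image.\<close>
lemma carry_run:
  assumes x: "1 \<le> x" "x \<le> n + 1"
  shows "carry (run x) (pos (run x) x) = 0" "carry (run x) (pos (run x) x - 1) = 0"
proof -
  obtain u where r: "run x = Suc u"
    using run_ge_1[OF x(2)] by (cases "run x") auto
  then have uz: "u \<le> z"
    using run_le[OF x(2)] by simp
  have no: "\<not> (\<rho> u (j - 1) + \<theta> u j < pos (Suc u) x \<and> pos (Suc u) x \<le> \<rho> u j + \<theta> u j)"
    if u1: "1 \<le> u" and j: "1 \<le> j" "j \<le> m u" for j
  proof
    assume y: "\<rho> u (j - 1) + \<theta> u j < pos (Suc u) x \<and> pos (Suc u) x \<le> \<rho> u j + \<theta> u j"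
    have "factor u (pos (Suc u) x - \<theta> u j) = factor u (pos u x)"
      using factor_block[OF u1 uz j, of "pos (Suc u) x - \<theta> u j"] y pos_step[OF u1 uz, of x] by auto
    then have "pos u x = pos (Suc u) x - \<theta> u j"
      using factor_eqD[OF u1 uz] by metis
    then have "pos u x \<le> bound u"
      using y rho_mono[OF j(2), of u] u1 uz by auto
    then show False
      using pos_le_iff_run[OF x(2) u1] uz r by simp
  qed
  show "carry (run x) (pos (run x) x) = 0"
    unfolding r using no by (intro carry_exterior) fastforce
  show "carry (run x) (pos (run x) x - 1) = 0"
    unfolding r using no by (intro carry_exterior) fastforce
qed


lemma kappa_mono:
  assumes u: "1 \<le> u" "u \<le> z" and ij: "1 \<le> i" "i \<le> j" "j \<le> m u"
  shows "kappa_minus n F u i \<le> kappa_minus n F u j" "kappa_plus n F u i \<le> kappa_plus n F u j"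
proof -
  have i: "1 \<le> i" "i \<le> m u" and j: "1 \<le> j" "j \<le> m u"
    using ij by auto
  note ri = rho_range[OF u i] and rj = rho_range[OF u j]
  have "tail_prod u (\<rho> u (i - 1) + 1) \<le> tail_prod u (\<rho> u (j - 1) + 1)"
    using tail_prod_mono[of u "\<rho> u (i - 1) + 1" "\<rho> u (j - 1) + 1"] rho_mono[OF diff_le_mono[OF ij(2), of 1], of u] rj u ij
    by (cases "\<rho> u (i - 1) = \<rho> u (j - 1)") auto
  then show "kappa_minus n F u i \<le> kappa_minus n F u j"
    using kappa_minus_eq_tail_prod[OF u i] kappa_minus_eq_tail_prod[OF u j] by simp
  have "tail_prod u (\<rho> u i) \<le> tail_prod u (\<rho> u j)"
    using tail_prod_mono[of u "\<rho> u i" "\<rho> u j"] rho_mono[OF ij(2), of u] ri rj u ij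
    by (cases "\<rho> u i = \<rho> u j") auto
  then show "kappa_plus n F u i \<le> kappa_plus n F u j"
    using kappa_plus_eq_tail_prod[OF u i] kappa_plus_eq_tail_prod[OF u j] by simp
qed

text \<open>The condition in the definition of \<open>\<chi>\<close>.\<close>
definition outside :: "nat \<Rightarrow> nat \<Rightarrow> bool" where
  "outside u k \<longleftrightarrow>
     (\<exists>j'. 1 \<le> j' \<and> j' < m u \<and> kappa_plus n F u j' \<le> k \<and> k < kappa_minus n F u (j' + 1)) \<or>
      k < kappa_minus n F u 1 \<or> kappa_plus n F u (m u) \<le> k"

text \<open>The intervals from \<open>\<kappa>\<^sub>-\<close> to \<open>\<kappa>\<^sub>+\<close> of one factor are ordered by their index, so avoiding all of
  them means lying before the first, behind the last, or between two neighbours.\<close>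
lemma outside_iff:
  assumes u: "1 \<le> u" "u \<le> z"
  shows "outside u k \<longleftrightarrow>
    (\<forall>j. 1 \<le> j \<longrightarrow> j \<le> m u \<longrightarrow> kappa_minus n F u j \<le> k \<longrightarrow> kappa_plus n F u j \<le> k)"
proof (intro iffI allI impI)
  fix i
  assume out: "outside u k" and i: "1 \<le> i" "i \<le> m u" "kappa_minus n F u i \<le> k"
  from out consider j where "1 \<le> j" "j < m u" "kappa_plus n F u j \<le> k" "k < kappa_minus n F u (j + 1)"
    | "k < kappa_minus n F u 1" | "kappa_plus n F u (m u) \<le> k"
    unfolding outside_def by blast
  then show "kappa_plus n F u i \<le> k"
  proof cases
    case 1
    then show ?thesis
      using kappa_mono(2)[OF u i(1), of j] kappa_mono(1)[OF u, of "j + 1" i] i by (cases "i \<le> j") auto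
  next
    case 2
    then show ?thesis
      using kappa_mono(1)[OF u, of 1 i] i by auto
  next
    case 3
    then show ?thesis
      using kappa_mono(2)[OF u i(1,2)] by simp
  qed
next
  assume all: "\<forall>j. 1 \<le> j \<longrightarrow> j \<le> m u \<longrightarrow> kappa_minus n F u j \<le> k \<longrightarrow> kappa_plus n F u j \<le> k"
  show "outside u k"
  proof (rule ccontr)
    assume "\<not> outside u k"
    then have no: "\<And>j. 1 \<le> j \<Longrightarrow> j < m u \<Longrightarrow> kappa_plus n F u j \<le> k \<Longrightarrow> kappa_minus n F u (j + 1) \<le> k"
      and first: "kappa_minus n F u 1 \<le> k" and last: "k < kappa_plus n F u (m u)"
      unfolding outside_def by (meson not_le)+
    have "kappa_plus n F u j \<le> k" if "1 \<le> j" "j \<le> m u" for j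
      using that
    proof (induction j rule: dec_induct)
      case base
      then show ?case using all first by simp
    next
      case (step j)
      then show ?case using all no[of j] by simp
    qed
    then show False
      using last m_pos[OF u] by fastforce
  qed
qed

lemma interior_iff:
  assumes u: "1 \<le> u" "u \<le> z" and j: "1 \<le> j" "j \<le> m u" and k: "1 \<le> k" "pos (Suc u) k \<le> bound (Suc u)"
  shows "kappa_minus n F u j < k \<and> k < kappa_plus n F u j \<longleftrightarrow>
    \<rho> u (j - 1) < pos u k \<and> pos u k < \<rho> u j"
proof -
  note r = rho_range[OF u j]
  let ?a = "factor u (\<rho> u (j - 1) + 1)" and ?b = "factor u (\<rho> u j)" and ?y = "pos (Suc u) k"
  have ab: "?a = \<rho> u (j - 1) + 1 + \<theta> u j" "?b = \<rho> u j + \<theta> u j"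
    using factor_block[OF u j] rho_less[OF u j] by auto
  have range: "1 \<le> ?a" "?a \<le> bound (Suc u)" "1 \<le> ?b" "?b \<le> bound (Suc u)" "1 \<le> ?y"
    using factor_range[OF u, of "\<rho> u (j - 1) + 1"] factor_range[OF u, of "\<rho> u j"] r
      pos_ge_1[OF k(1)] by auto
  have km: "kappa_minus n F u j + 1 = tail_prod (Suc u) ?a" and kp: "kappa_plus n F u j = tail_prod (Suc u) ?b"
    using kappa_minus_eq_tail_prod[OF u j] kappa_plus_eq_tail_prod[OF u j] tail_prod_step[OF u] by auto
  have "k < kappa_plus n F u j \<longleftrightarrow> ?y < ?b"
    using tail_prod_less_iff[of "Suc u" ?y ?b] range k u by (simp add: kp)
  moreover have "k < kappa_minus n F u j + 1 \<longleftrightarrow> ?y < ?a"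
    unfolding km using tail_prod_less_iff[of "Suc u" ?y ?a] range k u by simp
  then have "kappa_minus n F u j < k \<longleftrightarrow> ?a \<le> ?y"
    by linarith
  moreover have "?a \<le> ?y \<and> ?y < ?b \<longleftrightarrow> \<rho> u (j - 1) < pos u k \<and> pos u k < \<rho> u j"
  proof
    assume "\<rho> u (j - 1) < pos u k \<and> pos u k < \<rho> u j"
    then show "?a \<le> ?y \<and> ?y < ?b"
      using pos_step[OF u, of k] factor_block[OF u j, of "pos u k"] ab by auto
  next
    assume y: "?a \<le> ?y \<and> ?y < ?b"
    then have "factor u (?y - \<theta> u j) = factor u (pos u k)"
      using pos_step[OF u, of k] factor_block[OF u j, of "?y - \<theta> u j"] ab by auto
    then have "pos u k = ?y - \<theta> u j"
      using factor_eqD[OF u] by metis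
    then show "\<rho> u (j - 1) < pos u k \<and> pos u k < \<rho> u j"
      using y ab by auto
  qed
  ultimately show ?thesis by blast
qed

text \<open>Both sides satisfy the same recursion in \<open>v\<close>. If \<open>k\<close> is outside the intervals of the factor \<open>u\<close>, then both
  become zero in the step from \<open>u\<close> to \<open>u + 1\<close>; otherwise both grow by the translation of the block that
  contains \<open>k\<close>.\<close>
lemma theta_sum_eq_carry:
  assumes k: "1 \<le> k"
    and no_minus: "\<And>u j. 1 \<le> u \<Longrightarrow> u \<le> z \<Longrightarrow> 1 \<le> j \<Longrightarrow> j \<le> m u \<Longrightarrow> kappa_minus n F u j \<noteq> k"
    and v: "1 \<le> v" "v \<le> Suc z" "pos v k \<le> bound v"
  shows "(\<Sum>v' = Max (insert 0 {v'. 1 \<le> v' \<and> v' < v \<and> outside v' k}) + 1..v - 1.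
      \<theta> v' (THE j'. 1 \<le> j' \<and> j' \<le> m v' \<and> kappa_minus n F v' j' < k \<and> k < kappa_plus n F v' j')) =
    carry v (pos v k)"
  using v
proof (induction v rule: dec_induct)
  case base
  show ?case
    using carry_exterior[of 0] by simp
next
  case (step u)
  then have u: "1 \<le> u" "u \<le> z" by auto
  define X where "X = {v'. 1 \<le> v' \<and> v' < u \<and> outside v' k}"
  define \<tau> where "\<tau> = (\<lambda>v'. \<theta> v' (THE j'. 1 \<le> j' \<and> j' \<le> m v' \<and> kappa_minus n F v' j' < k \<and>
    k < kappa_plus n F v' j'))"
  have X: "finite X" "\<forall>x\<in>X. x < u"
    by (auto simp: X_def)
  show ?case
  proof (cases "outside u k")
    case True
    then have "{v'. 1 \<le> v' \<and> v' < Suc u \<and> outside v' k} = insert u X"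
      using u by (auto simp: X_def less_Suc_eq)
    moreover have "Max (insert 0 (insert u X)) = u"
      using X by (intro Max_eqI) auto
    moreover have "carry (Suc u) (pos (Suc u) k) = 0"
    proof (rule carry_exterior)
      fix j
      assume j: "1 \<le> j" "j \<le> m u" and y: "\<rho> u (j - 1) + \<theta> u j < pos (Suc u) k"
        "pos (Suc u) k < \<rho> u j + \<theta> u j"
      have "factor u (pos (Suc u) k - \<theta> u j) = factor u (pos u k)"
        using factor_block[OF u j, of "pos (Suc u) k - \<theta> u j"] y pos_step[OF u, of k] by auto
      then have "pos u k = pos (Suc u) k - \<theta> u j"
        using factor_eqD[OF u] by metis
      then have "kappa_minus n F u j < k \<and> k < kappa_plus n F u j"
        using interior_iff[OF u j k] step.prems y by auto
      then show False
        using True j unfolding outside_iff[OF u] by fastforce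
    qed
    ultimately show ?thesis by simp
  next
    case False
    then obtain j where j: "1 \<le> j" "j \<le> m u" and "kappa_minus n F u j \<le> k" "k < kappa_plus n F u j"
      unfolding outside_iff[OF u] by (auto simp: not_le)
    then have jk: "kappa_minus n F u j < k \<and> k < kappa_plus n F u j"
      using no_minus[OF u j] by simp
    have int: "\<rho> u (i - 1) < pos u k \<and> pos u k < \<rho> u i"
      if "1 \<le> i" "i \<le> m u" "kappa_minus n F u i < k \<and> k < kappa_plus n F u i" for i
      using interior_iff[OF u that(1,2) k] step.prems that by simp
    have "(THE j'. 1 \<le> j' \<and> j' \<le> m u \<and> kappa_minus n F u j' < k \<and> k < kappa_plus n F u j') = j"
    proof (rule the_equality)
      show "i = j" if "1 \<le> i \<and> i \<le> m u \<and> kappa_minus n F u i < k \<and> k < kappa_plus n F u i" for i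
        using int[of i] int[OF j jk] that by (intro block_unique[of u i "pos u k" j]) auto
    qed (use j jk in auto)
    then have \<tau>u: "\<tau> u = \<theta> u j"
      by (simp add: \<tau>_def)
    have Xu: "{v'. 1 \<le> v' \<and> v' < Suc u \<and> outside v' k} = X"
      using False by (auto simp: X_def less_Suc_eq)
    have "Max (insert 0 X) < u"
      using X u by (subst Max_less_iff) auto
    then have "{Max (insert 0 X) + 1..u} = insert u {Max (insert 0 X) + 1..u - 1}"
      by auto
    moreover have "u \<notin> {Max (insert 0 X) + 1..u - 1}"
      using u by auto
    ultimately have "(\<Sum>v' = Max (insert 0 X) + 1..u. \<tau> v') = \<theta> u j + (\<Sum>v' = Max (insert 0 X) + 1..u - 1. \<tau> v')"
      using \<tau>u by (metis finite_atLeastAtMost sum.insert)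
    moreover have "pos u k \<le> bound u"
      using int[OF j jk] rho_mono[OF j(2), of u] u by simp
    then have "(\<Sum>v' = Max (insert 0 X) + 1..u - 1. \<tau> v') = carry u (pos u k)"
      using step.IH u unfolding X_def \<tau>_def by simp
    moreover have "carry (Suc u) (pos (Suc u) k) = \<theta> u j + carry u (pos u k)"
      using carry_interior[OF u j, of "pos u k"] int[OF j jk] pos_step[OF u, of k]
        factor_block[OF u j, of "pos u k"] by simp
    ultimately show ?thesis
      unfolding Xu \<tau>_def by simp
  qed
qed

text \<open>This includes the two conventions \<open>\<eta> = 0\<close>: there is no gap inside a block before the place \<open>1\<close>, and
  the place \<open>M v\<close> is not before the end of any image of a block of the preceding factor.\<close>
lemma eta_eq_carry:
  assumes v: "1 \<le> v" "v \<le> z" and j: "j \<le> m v"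
  shows "eta n F v j = carry v (\<rho> v j)"
proof -
  obtain u where u: "v = Suc u"
    using v by (cases v) auto
  consider "j = 0" | "j = m v" | "1 \<le> j" "j < m v"
    using j by linarith
  then show ?thesis
  proof cases
    case 1
    have "carry (Suc u) 0 = 0"
      by (rule carry_exterior) auto
    then show ?thesis
      using 1 u by (simp add: eta_def)
  next
    case 2
    have "carry (Suc u) (M v) = 0"
    proof (rule carry_exterior)
      fix i
      assume i: "1 \<le> u" "1 \<le> i" "i \<le> m u" "M v < \<rho> u i + \<theta> u i"
      have "\<theta> u i \<le> \<theta> u (m u)"
        using theta_less[of u i "m u"] i u v by (cases "i = m u") auto
      then show False
        using rho_mono[OF i(3), of u] top_le_bound[of u] i u v by simp
    qed
    then show ?thesis
      using 2 u by (simp add: eta_def)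
  next
    case 3
    define k where "k = kappa_plus n F v j"
    have pk: "pos v k = \<rho> v j"
      using kappa_plus_eq_iff[OF v, of j k] 3 by (simp add: k_def)
    have "(\<Sum>v' = Max (insert 0 {v'. 1 \<le> v' \<and> v' < v \<and> outside v' k}) + 1..v - 1.
        \<theta> v' (THE j'. 1 \<le> j' \<and> j' \<le> m v' \<and> kappa_minus n F v' j' < k \<and> k < kappa_plus n F v' j')) =
      carry v (pos v k)"
    proof (rule theta_sum_eq_carry)
      show "1 \<le> k"
        using kappa_plus_range(1)[OF v, of j] 3 by (simp add: k_def)
      show "kappa_minus n F u i \<noteq> k" if "1 \<le> u" "u \<le> z" "1 \<le> i" "i \<le> m u" for u i
        using kappa_plus_neq_kappa_minus[OF v, of j u i] that 3 by (auto simp: k_def)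
      show "pos v k \<le> bound v"
        using rho_range[OF v, of j] 3 v pk by simp
    qed (use v in auto)
    then show ?thesis
      using 3 by (simp add: eta_def chi_def outside_def k_def[symmetric] pk)
  qed
qed

lemma finite_fac_index: "finite (fac_index F)"
proof -
  have "fac_index F = Sigma {1..z} (\<lambda>v. {1..m v})"
    by (auto simp: fac_index_def)
  then show ?thesis by simp
qed

section \<open>The exponents of the inverse\<close>

text \<open>The total translation of \<open>k\<close> from its own run up to the factor \<open>v\<close> splits at the factors in which
  \<open>k\<close> ends its block. The \<open>carry\<close> at \<open>v\<close> is the part since the last such factor; when \<open>k\<close> ends a
  block again, it is transferred to the sum and starts anew from zero.\<close>
lemma sum_theta_carry_plus:
  assumes k: "1 \<le> k" "k \<le> n" and v: "run k \<le> v" "v \<le> Suc z"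
  shows "(\<Sum>(w, x)\<in>{(w, x)\<in>fac_index F. w < v \<and> pos w k = \<rho> w x}. \<theta> w x + carry w (\<rho> w x)) +
    carry v (pos v k) + pos (run k) k = pos v k"
  using v
proof (induction v rule: dec_induct)
  case base
  have empty: "{(w, x)\<in>fac_index F. w < run k \<and> pos w k = \<rho> w x} = {}"
  proof -
    have False if w: "1 \<le> w" "w \<le> z" "1 \<le> x" "x \<le> m w" "w < run k" "pos w k = \<rho> w x" for w x
      using pos_le_iff_run[of k w] rho_range[OF w(1-4)] w k by simp
    then show ?thesis by (auto simp: fac_index_def)
  qed
  show ?case
    unfolding empty using carry_run(1)[of k] k by simp
next
  case (step v)
  then have v: "1 \<le> v" "v \<le> z"
    using run_ge_1[of k] k by auto
  have "pos v k \<le> M v"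
    using pos_le_iff_run[of k v] step v k by simp
  then obtain j where j: "1 \<le> j" "j \<le> m v" and b: "\<rho> v (j - 1) < pos v k" "pos v k \<le> \<rho> v j"
    using block_exists[OF pos_ge_1[OF k(1)]] by metis
  have next_pos: "pos (Suc v) k = pos v k + \<theta> v j"
    using pos_step[OF v] factor_block[OF v j b] by simp
  let ?S = "\<lambda>v. {(w, x)\<in>fac_index F. w < v \<and> pos w k = \<rho> w x}"
  have only_j: "x = j" if "1 \<le> x" "x \<le> m v" "pos v k = \<rho> v x" for x
    using that b rho_less[OF v that(1,2)] by (intro block_unique[of v x "pos v k" j]) auto
  show ?case
  proof (cases "pos v k = \<rho> v j")
    case True
    have "?S (Suc v) = insert (v, j) (?S v)"
      using only_j True v j by (auto simp: fac_index_def less_Suc_eq)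
    moreover have "(v, j) \<notin> ?S v" "finite (?S v)"
      by (auto intro: finite_subset[OF _ finite_fac_index])
    moreover have "carry (Suc v) (pos (Suc v) k) = 0"
      using carry_block_end[OF v j] next_pos True by simp
    ultimately show ?thesis
      using step True next_pos by simp
  next
    case False
    then have "?S (Suc v) = ?S v"
      using only_j by (auto simp: fac_index_def less_Suc_eq)
    moreover have "carry (Suc v) (pos (Suc v) k) = \<theta> v j + carry v (pos v k)"
      using carry_interior[OF v j b(1)] b(2) next_pos False by simp
    ultimately show ?thesis
      using step next_pos by simp
  qed
qed

text \<open>The mirror image for the starts of blocks. The gap that matters is the one before \<open>l\<close>.\<close>
lemma sum_theta_carry_minus:
  assumes l: "1 \<le> l" "l \<le> n + 1" and v: "run l \<le> v" "v \<le> Suc z"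
  shows "(\<Sum>(w, x)\<in>{(w, x)\<in>fac_index F. w < v \<and> pos w l = \<rho> w (x - 1) + 1}.
      \<theta> w x + carry w (\<rho> w (x - 1))) + carry v (pos v l - 1) + pos (run l) l = pos v l"
  using v
proof (induction v rule: dec_induct)
  case base
  have empty: "{(w, x)\<in>fac_index F. w < run l \<and> pos w l = \<rho> w (x - 1) + 1} = {}"
  proof -
    have False if w: "1 \<le> w" "w \<le> z" "1 \<le> x" "x \<le> m w" "w < run l" "pos w l = \<rho> w (x - 1) + 1"
      for w x
      using pos_le_iff_run[of l w] rho_range[OF w(1-4)] w l by simp
    then show ?thesis by (auto simp: fac_index_def)
  qed
  show ?case
    unfolding empty using carry_run(2)[OF l] by simp
next
  case (step v)
  then have v: "1 \<le> v" "v \<le> z"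
    using run_ge_1[of l] l by auto
  have "pos v l \<le> M v"
    using pos_le_iff_run[of l v] step v l by simp
  then obtain j where j: "1 \<le> j" "j \<le> m v" and b: "\<rho> v (j - 1) < pos v l" "pos v l \<le> \<rho> v j"
    using block_exists[OF pos_ge_1[OF l(1)]] by metis
  have next_pos: "pos (Suc v) l = pos v l + \<theta> v j"
    using pos_step[OF v] factor_block[OF v j b] by simp
  let ?S = "\<lambda>v. {(w, x)\<in>fac_index F. w < v \<and> pos w l = \<rho> w (x - 1) + 1}"
  have only_j: "x = j" if "1 \<le> x" "x \<le> m v" "pos v l = \<rho> v (x - 1) + 1" for x
    using that b rho_less[OF v that(1,2)] by (intro block_unique[of v x "pos v l" j]) auto
  show ?case
  proof (cases "pos v l = \<rho> v (j - 1) + 1")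
    case True
    have "?S (Suc v) = insert (v, j) (?S v)"
      using only_j True v j by (auto simp: fac_index_def less_Suc_eq)
    moreover have "(v, j) \<notin> ?S v" "finite (?S v)"
      by (auto intro: finite_subset[OF _ finite_fac_index])
    moreover have "carry (Suc v) (pos (Suc v) l - 1) = 0"
      using carry_block_start[OF v j] next_pos True by simp
    ultimately show ?thesis
      using step True next_pos by simp
  next
    case False
    then have "?S (Suc v) = ?S v"
      using only_j by (auto simp: fac_index_def less_Suc_eq)
    moreover have "carry (Suc v) (pos v l - 1 + \<theta> v j) = \<theta> v j + carry v (pos v l - 1)"
      using b False by (intro carry_interior[OF v j]) auto
    moreover have "pos v l - 1 + \<theta> v j = pos (Suc v) l - 1"
      using b next_pos by simp
    ultimately show ?thesis
      using step next_pos by simp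
  qed
qed

text \<open>The factor before the run of \<open>k + 1\<close> brings \<open>k\<close> next to \<open>k + 1\<close>, although \<open>k + 1\<close> was not in one of its
  blocks. Hence \<open>k\<close> ends its block there.\<close>
lemma ascent_block_end:
  assumes k: "1 \<le> k" "k \<le> n" and r: "run k \<le> u" "run (k + 1) = Suc u"
  obtains i where "1 \<le> u" "u \<le> z" "1 \<le> i" "i \<le> m u" "pos u k = \<rho> u i"
proof -
  have u: "1 \<le> u" "u \<le> z"
    using r run_ge_1[of k] run_le[of "k + 1"] k by auto
  have le: "pos u k \<le> M u" and gt: "M u < pos u (k + 1)"
    using pos_le_iff_run[of k u] pos_le_iff_run[of "k + 1" u] u k r by auto
  obtain i where i: "1 \<le> i" "i \<le> m u" and b: "\<rho> u (i - 1) < pos u k" "pos u k \<le> \<rho> u i"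
    using block_exists[OF pos_ge_1[OF k(1)] le] by metis
  have "pos (Suc u) (k + 1) = pos (Suc u) k + 1"
    using pos_le_iff_run[of k "Suc u"] pos_le_iff_run[of "k + 1" "Suc u"] u k r
    by (intro pos_consecutive) auto
  then have f: "factor u (pos u (k + 1)) = pos u k + \<theta> u i + 1"
    using pos_step[OF u] factor_block[OF u i b] by simp
  have "pos u k = \<rho> u i"
  proof (rule ccontr)
    assume "pos u k \<noteq> \<rho> u i"
    then have b': "pos u k + 1 \<le> \<rho> u i"
      using b by simp
    then have "factor u (pos u k + 1) = factor u (pos u (k + 1))"
      using factor_block[OF u i, of "pos u k + 1"] f b by simp
    then have "pos u k + 1 = pos u (k + 1)"
      using factor_eqD[OF u] by metis
    then show False
      using gt b' rho_mono[OF i(2), of u] by simp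
  qed
  then show thesis
    using that u i by blast
qed

lemma descent_block_start:
  assumes k: "1 \<le> k" "k \<le> n" and r: "run (k + 1) \<le> u" "run k = Suc u"
  obtains i where "1 \<le> u" "u \<le> z" "1 \<le> i" "i \<le> m u" "pos u (k + 1) = \<rho> u (i - 1) + 1"
proof -
  have u: "1 \<le> u" "u \<le> z"
    using r run_ge_1[of "k + 1"] run_le[of k] k by auto
  have le: "pos u (k + 1) \<le> M u" and gt: "M u < pos u k"
    using pos_le_iff_run[of k u] pos_le_iff_run[of "k + 1" u] u k r by auto
  obtain i where i: "1 \<le> i" "i \<le> m u" and b: "\<rho> u (i - 1) < pos u (k + 1)" "pos u (k + 1) \<le> \<rho> u i"
    using block_exists[OF pos_ge_1 le] by auto
  have "pos (Suc u) (k + 1) = pos (Suc u) k + 1"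
    using pos_le_iff_run[of k "Suc u"] pos_le_iff_run[of "k + 1" "Suc u"] u k r
    by (intro pos_consecutive) auto
  then have f: "factor u (pos u k) + 1 = pos u (k + 1) + \<theta> u i"
    using pos_step[OF u] factor_block[OF u i b] by simp
  have "pos u (k + 1) = \<rho> u (i - 1) + 1"
  proof (rule ccontr)
    assume "pos u (k + 1) \<noteq> \<rho> u (i - 1) + 1"
    then have b': "\<rho> u (i - 1) < pos u (k + 1) - 1"
      using b by simp
    then have "factor u (pos u (k + 1) - 1) = factor u (pos u k)"
      using factor_block[OF u i, of "pos u (k + 1) - 1"] f b by simp
    then have "pos u (k + 1) - 1 = pos u k"
      using factor_eqD[OF u] by metis
    then show False
      using gt le by simp
  qed
  then show thesis
    using that u i by blast
qed

text \<open>The telescoping sum is taken up to the run of \<open>k + 1\<close>. There the remaining \<open>carry\<close> is zero since \<open>k\<close> ends a block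
  of the factor before, and by \<open>kappa_plus_ascent\<close> no later factor contributes a pair with \<open>\<kappa>\<^sub>+ = k\<close>.\<close>
lemma exponent_kappa_plus:
  assumes vj: "(v, j) \<in> fac_index F"
  defines "k \<equiv> kappa_plus n F v j"
  shows "ogs_exponent (inv p) k =
    (\<Sum>(w, x)\<in>{(w, x)\<in>fac_index F. kappa_plus n F w x = k}. \<theta> w x + eta n F w x)"
proof -
  have v: "1 \<le> v" "v \<le> z" "1 \<le> j" "j \<le> m v"
    using vj by (auto simp: fac_index_def)
  have k: "1 \<le> k" "k \<le> n"
    using kappa_plus_range[OF v] by (auto simp: k_def)
  have plus: "kappa_plus n F w x = k \<longleftrightarrow> w < run (k + 1) \<and> pos w k = \<rho> w x"
    if "(w, x) \<in> fac_index F" for w x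
    using that kappa_plus_eq_iff[of w x k] kappa_plus_ascent[of w x k] k
    by (auto simp: fac_index_def)
  have "pos v k = \<rho> v j"
    using kappa_plus_eq_iff[OF v, of k] by (simp add: k_def)
  then have r: "run k \<le> v" "v < run (k + 1)"
    using kappa_plus_ascent[OF v k] by auto
  obtain u where u: "run (k + 1) = Suc u" "run k \<le> u"
    using r by (cases "run (k + 1)") auto
  obtain i where i: "1 \<le> u" "u \<le> z" "1 \<le> i" "i \<le> m u" "pos u k = \<rho> u i"
    by (rule ascent_block_end[OF k u(2,1)])
  have "pos (Suc u) k = \<rho> u i + \<theta> u i"
    using pos_step[OF i(1,2), of k] factor_block[OF i(1-4), of "pos u k"] rho_less[OF i(1-4)] i(5)
    by simp
  then have "carry (run (k + 1)) (pos (run (k + 1)) k) = 0"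
    using carry_block_end[OF i(1-4)] u by simp
  then have "ogs_exponent (inv p) k = (\<Sum>(w, x)\<in>{(w, x)\<in>fac_index F. w < run (k + 1) \<and> pos w k = \<rho> w x}.
      \<theta> w x + carry w (\<rho> w x))"
    using sum_theta_carry_plus[OF k, of "run (k + 1)"] exponent_ascent(2)[OF k] r k run_le[of "k + 1"]
    by simp
  also have "\<dots> = (\<Sum>(w, x)\<in>{(w, x)\<in>fac_index F. kappa_plus n F w x = k}. \<theta> w x + eta n F w x)"
    using plus by (intro sum.cong) (auto simp: fac_index_def eta_eq_carry)
  finally show ?thesis .
qed

lemma exponent_kappa_minus:
  assumes vj: "(v, j) \<in> fac_index F" and k0: "kappa_minus n F v j = k" "k \<noteq> 0"
  shows "ogs_exponent (inv p) k +
    (\<Sum>(w, x)\<in>{(w, x)\<in>fac_index F. kappa_minus n F w x = k}. \<theta> w x + eta n F w (x - 1)) = k"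
proof -
  have v: "1 \<le> v" "v \<le> z" "1 \<le> j" "j \<le> m v"
    using vj by (auto simp: fac_index_def)
  have k: "1 \<le> k" "k \<le> n" and l: "1 \<le> k + 1" "k + 1 \<le> n + 1"
    using kappa_minus_less[OF v] k0 by auto
  have minus: "kappa_minus n F w x = k \<longleftrightarrow> w < run k \<and> pos w (k + 1) = \<rho> w (x - 1) + 1"
    if "(w, x) \<in> fac_index F" for w x
    using that kappa_minus_eq_iff[of w x k] kappa_minus_descent[of w x k] k
    by (auto simp: fac_index_def)
  have "pos v (k + 1) = \<rho> v (j - 1) + 1"
    using kappa_minus_eq_iff[OF v, of k] k0 by simp
  then have r: "run (k + 1) \<le> v" "v < run k"
    using kappa_minus_descent[OF v k] by auto
  obtain u where u: "run k = Suc u" "run (k + 1) \<le> u"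
    using r by (cases "run k") auto
  obtain i where i: "1 \<le> u" "u \<le> z" "1 \<le> i" "i \<le> m u" "pos u (k + 1) = \<rho> u (i - 1) + 1"
    by (rule descent_block_start[OF k u(2,1)])
  have "pos (Suc u) (k + 1) - 1 = \<rho> u (i - 1) + \<theta> u i"
    using pos_step[OF i(1,2), of "k + 1"] factor_block[OF i(1-4), of "pos u (k + 1)"]
      rho_less[OF i(1-4)] i(5) by simp
  then have "carry (run k) (pos (run k) (k + 1) - 1) = 0"
    using carry_block_start[OF i(1-4)] u by simp
  then have "ogs_exponent (inv p) k + (\<Sum>(w, x)\<in>{(w, x)\<in>fac_index F. w < run k \<and>
      pos w (k + 1) = \<rho> w (x - 1) + 1}. \<theta> w x + carry w (\<rho> w (x - 1))) = k"
    using sum_theta_carry_minus[OF l, of "run k"] exponent_descent(2)[OF k] r k run_le[of k] by simp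
  also have "(\<Sum>(w, x)\<in>{(w, x)\<in>fac_index F. w < run k \<and>
      pos w (k + 1) = \<rho> w (x - 1) + 1}. \<theta> w x + carry w (\<rho> w (x - 1))) =
    (\<Sum>(w, x)\<in>{(w, x)\<in>fac_index F. kappa_minus n F w x = k}. \<theta> w x + eta n F w (x - 1))"
    using minus by (intro sum.cong) (auto simp: fac_index_def eta_eq_carry)
  finally show ?thesis .
qed

lemma des_inv: "des n (inv p) = kappa_minus_values n F"
proof (intro equalityI subsetI)
  fix k
  assume "k \<in> des n (inv p)"
  then have k: "1 \<le> k" "k \<le> n" and d: "inv p (k + 1) < inv p k"
    by (auto simp: des_def)
  have "run (k + 1) < run k"
    using exponent_ascent(1)[OF k] d by (cases "run k \<le> run (k + 1)") auto
  then obtain u where u: "run k = Suc u" "run (k + 1) \<le> u"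
    by (cases "run k") auto
  obtain i where i: "1 \<le> u" "u \<le> z" "1 \<le> i" "i \<le> m u" "pos u (k + 1) = \<rho> u (i - 1) + 1"
    by (rule descent_block_start[OF k u(2,1)])
  then have "kappa_minus n F u i = k"
    using kappa_minus_eq_iff by blast
  moreover have "(u, i) \<in> fac_index F"
    using i by (simp add: fac_index_def)
  ultimately show "k \<in> kappa_minus_values n F"
    unfolding kappa_minus_values_def using k by fastforce
next
  fix k
  assume "k \<in> kappa_minus_values n F"
  then obtain v j where v: "1 \<le> v" "v \<le> z" "1 \<le> j" "j \<le> m v" and k0: "kappa_minus n F v j = k" "k \<noteq> 0"
    by (auto simp: kappa_minus_values_def fac_index_def)
  have k: "1 \<le> k" "k \<le> n" "k \<le> n - 1"
    using kappa_minus_less[OF v] k0 by auto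
  have "pos v (k + 1) = \<rho> v (j - 1) + 1"
    using kappa_minus_eq_iff[OF v, of k] k0 by simp
  then have "run (k + 1) < run k"
    using kappa_minus_descent[OF v k(1,2)] by auto
  then show "k \<in> des n (inv p)"
    using exponent_descent(1)[OF k(1,2)] k by (simp add: des_def)
qed

lemma kappa_values_subset: "kappa_values n F \<subseteq> {1..n}"
proof
  fix k
  assume "k \<in> kappa_values n F"
  then obtain v j where v: "1 \<le> v" "v \<le> z" "1 \<le> j" "j \<le> m v"
    and "k = kappa_minus n F v j \<or> k = kappa_plus n F v j" "k \<noteq> 0"
    by (auto simp: kappa_values_def fac_index_def)
  then show "k \<in> {1..n}"
    using kappa_minus_less[OF v] kappa_plus_range[OF v] by auto
qed

lemma exponent_outside_kappa_values:
  assumes "k \<in> {1..n} - kappa_values n F"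
  shows "ogs_exponent (inv p) k = 0"
proof -
  have k: "1 \<le> k" "k \<le> n"
    using assms by auto
  have not: "kappa_plus n F v j \<noteq> k" "kappa_minus n F v j \<noteq> k"
    if "1 \<le> v" "v \<le> z" "1 \<le> j" "j \<le> m v" for v j
    using assms that by (auto simp: kappa_values_def fac_index_def)
  have "run k = run (k + 1)"
  proof (rule ccontr)
    assume "run k \<noteq> run (k + 1)"
    then consider u where "run (k + 1) = Suc u" "run k \<le> u" | u where "run k = Suc u" "run (k + 1) \<le> u"
      by (cases "run k"; cases "run (k + 1)") (auto simp: linorder_neq_iff less_Suc_eq_le)
    then show False
    proof cases
      case (1 u)
      obtain i where "1 \<le> u" "u \<le> z" "1 \<le> i" "i \<le> m u" "pos u k = \<rho> u i"
        by (rule ascent_block_end[OF k 1(2,1)])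
      then show False
        using kappa_plus_eq_iff not by blast
    next
      case (2 u)
      obtain i where "1 \<le> u" "u \<le> z" "1 \<le> i" "i \<le> m u" "pos u (k + 1) = \<rho> u (i - 1) + 1"
        by (rule descent_block_start[OF k 2(2,1)])
      then show False
        using kappa_minus_eq_iff not by blast
    qed
  qed
  then show ?thesis
    using exponent_ascent(2)[OF k] by simp
qed

end

section \<open>Presentations and descents\<close>

lemma no_descent_eq_id:
  assumes "q permutes {1..n}" "des n q = {}"
  shows "q = id"
proof -
  have "(\<Sum>k = 1..n. ogs_exponent q k) = 0"
    using sum_ogs_exponent[OF assms(1)] assms(2) by (simp add: maj_def)
  then have "ogs_exponent q k = 0" if "k \<in> {1..n}" for k
    using that by simp
  then have "ogs_prod [] = q"
    using ogs_canonical_form(2)[OF assms(1), of "{}"] by simp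
  then show ?thesis
    by (metis eq_id_iff ogs_prod_simps(1))
qed

text \<open>The canonical form is elementary: its exponents add up to \<open>maj\<close>, which is \<open>d\<close>, and below \<open>d\<close>
  the permutation is increasing, so all exponents with smaller index are zero.\<close>
lemma elementary_word_of_single_descent:
  assumes q: "q permutes {1..n}" and d: "des n q = {d}"
  obtains xs where "ogs_elementary n xs" "ogs_prod xs = q" "sum_list (map snd xs) = d"
proof -
  define ys where "ys = map (\<lambda>k. (k, ogs_exponent q k)) (sorted_list_of_set {1..n})"
  define xs where "xs = filter (\<lambda>(k, i). i \<noteq> 0) ys"
  have can: "ogs_canonical n xs" and prod: "ogs_prod xs = q"
    unfolding xs_def ys_def by (rule ogs_canonical_form[OF q]; simp)+
  have "sum_list (map snd xs) = sum_list (map snd ys)"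
    unfolding xs_def by (induction ys) auto
  also have "\<dots> = (\<Sum>k\<in>{1..n}. ogs_exponent q k)"
    using sum.distinct_set_conv_list[of "sorted_list_of_set {1..n}" "ogs_exponent q"]
    by (simp add: ys_def comp_def)
  also have "\<dots> = d"
    using sum_ogs_exponent[OF q] d by (simp add: maj_def)
  finally have sum: "sum_list (map snd xs) = d" .
  have "1 \<le> d"
    using d by (auto simp: des_def)
  then have ne: "xs \<noteq> []"
    using sum by auto
  have inc: "q x \<le> q y" if "1 \<le> x" "x \<le> y" "y \<le> d" for x y
    using that(2,1,3)
  proof (induction y rule: dec_induct)
    case (step y)
    have "y \<notin> des n q" "d \<in> des n q"
      using d step by auto
    then have "q y \<le> q (y + 1)"
      using step by (auto simp: des_def)
    then show ?case using step by simp
  qed simp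
  have "ogs_exponent q k = 0" if "1 \<le> k" "k < d" for k
  proof -
    have "{x \<in> {1..k}. q x \<le> q k} = {1..k}" "{x \<in> {1..k}. q x \<le> q (k + 1)} = {1..k}"
      using inc that by auto
    then have "rank_below q k (q k) = k" "rank_below q k (q (k + 1)) = k"
      by (simp_all add: rank_below_def)
    moreover have "q k < q (k + 1)"
      using inc[of k "k + 1"] injD[OF permutes_inj[OF q], of k "k + 1"] that by (intro le_neq_trans) auto
    ultimately show ?thesis
      by (simp add: ogs_exponent_def)
  qed
  then have "d \<le> k" if "(k, i) \<in> set xs" for k i
    using that by (force simp: xs_def ys_def)
  then have "d \<le> fst (hd xs)"
    using ne by (metis list.set_sel(1) prod.collapse)
  then show thesis
    using that[of xs] can prod ne sum by (simp add: ogs_elementary_def)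
qed

text \<open>Let \<open>d\<close> be the largest descent. The permutation is the product of the pattern \<open>W\<close> of its first \<open>d\<close> entries and the
  permutation that arises by sorting these entries. The latter has the only descent \<open>d\<close> and becomes the last
  factor. The pattern has all other descents and permutes only \<open>1, \<dots>, d\<close>, so the indices in its
  factors are at most \<open>d\<close>, as the definition of a presentation demands.\<close>
theorem presentation_exists:
  assumes "q permutes {1..n}"
  shows "\<exists>G. ogs_elementary_presentation n q G \<and> length G = card (des n q)"
  using assms
proof (induction n arbitrary: q rule: less_induct)
  case (less n)
  have fin: "finite (des n q)"
    by (rule finite_subset[of _ "{..n}"]) (auto simp: des_def)
  show ?case
  proof (cases "des n q = {}")
    case True
    then have "q = pprod []"
      using no_descent_eq_id[OF less.prems] by (simp add: pprod_def)
    then have "ogs_elementary_presentation n q []"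
      by (simp add: ogs_elementary_presentation_iff)
    then show ?thesis
      using True by (intro exI[of _ "[]"]) simp
  next
    case False
    define d where "d = Max (des n q)"
    have "d \<in> des n q" and max: "\<And>k. k \<in> des n q \<Longrightarrow> k \<le> d"
      using False fin by (auto simp: d_def)
    then have d: "1 \<le> d" "d \<le> n - 1" "d < n" "q (d + 1) < q d"
      by (auto simp: des_def)
    define W where "W = (\<lambda>y. if y \<in> {1..d} then rank_below q d (q y) else y)"
    have W_less: "W x < W y \<longleftrightarrow> q x < q y" if "x \<in> {1..d}" "y \<in> {1..d}" for x y
      using that rank_below_less[of y d "q x" q "q y"] rank_below_mono[of "q y" "q x" q d]
      by (cases "q x < q y") (auto simp: W_def)
    have inj: "inj_on W {1..d}"
    proof (rule inj_onI)
      fix x y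
      assume xy: "x \<in> {1..d}" "y \<in> {1..d}" "W x = W y"
      then have "q x = q y"
        using W_less[OF xy(1,2)] W_less[OF xy(2,1)] by simp
      then show "x = y"
        using permutes_inj[OF less.prems] by (simp add: inj_eq)
    qed
    have "W ` {1..d} \<subseteq> {1..d}"
      using rank_below_pos[of _ d q] rank_below_le[of q d] by (force simp: W_def)
    then have "bij_betw W {1..d} {1..d}"
      using inj by (simp only: bij_betw_def endo_inj_surj finite_atLeastAtMost simp_thms)
    then have W: "W permutes {1..d}"
      by (rule bij_imp_permutes) (auto simp: W_def)
    define \<sigma> where "\<sigma> = q \<circ> inv W"
    have \<sigma>W: "\<sigma> (W x) = q x" for x
      using permutes_inverses(2)[OF W] by (simp add: \<sigma>_def)
    have invW: "inv W x \<in> {1..d} \<longleftrightarrow> x \<in> {1..d}" "W (inv W x) = x" for x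
      using permutes_in_image[OF permutes_inv[OF W]] permutes_inverses(1)[OF W] by auto
    have \<sigma>_high: "\<sigma> x = q x" if "d < x" for x
      using \<sigma>W[of x] that by (simp add: W_def)
    have "\<sigma> permutes {1..n}"
      unfolding \<sigma>_def using d
      by (intro permutes_compose[OF permutes_subset[OF permutes_inv[OF W]] less.prems]) auto
    moreover have "des n \<sigma> = {d}"
    proof -
      have "k \<in> des n \<sigma> \<longleftrightarrow> k = d" for k
      proof -
        consider "k = 0 \<or> n \<le> k" | "1 \<le> k" "k < d" | "k = d" | "d < k" "k < n"
          by linarith
        then show ?thesis
        proof cases
          case 1
          then show ?thesis using d by (auto simp: des_def)
        next
          case 2
          then have "W (inv W k) < W (inv W (k + 1))"
            using invW(2) by simp
          then have "\<sigma> k < \<sigma> (k + 1)"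
            using W_less[of "inv W k" "inv W (k + 1)"] invW(1)[of k] invW(1)[of "k + 1"] 2
            by (simp add: \<sigma>_def)
          then show ?thesis
            using 2 by (auto simp: des_def)
        next
          case 3
          have "W d \<le> d"
            using rank_below_le by (simp add: W_def)
          then have "\<not> q (inv W d) < q d"
            using W_less[of "inv W d" d] invW[of d] d by simp
          then have "\<sigma> (d + 1) < \<sigma> d"
            using d \<sigma>_high[of "d + 1"] by (simp add: \<sigma>_def)
          then show ?thesis
            using 3 d by (simp add: des_def)
        next
          case 4
          then have "k \<notin> des n q"
            using max[of k] by auto
          then show ?thesis
            using 4 \<sigma>_high by (simp add: des_def)
        qed
      qed
      then show ?thesis by blast
    qed
    ultimately obtain xs where xs: "ogs_elementary n xs" "ogs_prod xs = \<sigma>" "sum_list (map snd xs) = d"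
      by (rule elementary_word_of_single_descent)
    have "des d W = des n q - {d}"
    proof -
      have "k \<in> des d W \<longleftrightarrow> k \<in> des n q - {d}" for k
      proof (cases "1 \<le> k \<and> k < d")
        case True
        then show ?thesis
          using W_less[of "k + 1" k] d by (auto simp: des_def)
      next
        case False
        then show ?thesis
          using max[of k] by (auto simp: des_def)
      qed
      then show ?thesis by blast
    qed
    then have card: "Suc (card (des d W)) = card (des n q)"
      using \<open>d \<in> des n q\<close> fin by (metis card_Suc_Diff1)
    obtain G where G: "ogs_elementary_presentation d W G" "length G = card (des d W)"
      using less.IH[OF d(3) W] by blast
    have el: "ogs_elementary d (G ! (v - 1))" if "1 \<le> v" "v \<le> length G" for v
      using that G by (auto simp: ogs_elementary_presentation_iff)
    have "ogs_elementary_presentation n q (G @ [xs])"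
      unfolding ogs_elementary_presentation_iff
    proof (intro conjI allI impI ballI)
      have "pprod (map ogs_prod (G @ [xs])) x = \<sigma> (W x)" for x
        using G xs(2) by (simp add: ogs_elementary_presentation_iff)
      then show "q = pprod (map ogs_prod (G @ [xs]))"
        using \<sigma>W by auto
    next
      fix ys
      assume "ys \<in> set (G @ [xs])"
      then consider "ogs_elementary d ys" | "ys = xs"
        using G by (auto simp: ogs_elementary_presentation_iff)
      then show "ogs_elementary n ys"
        using xs(1) d by cases (fastforce simp: ogs_elementary_def ogs_canonical_def)+
    next
      fix v
      assume v: "1 \<le> v \<and> v < length (G @ [xs])"
      show "fst (last ((G @ [xs]) ! (v - 1))) \<le> sum_list (map snd ((G @ [xs]) ! v))"
      proof (cases "v = length G")
        case True
        then have e: "ogs_elementary d (G ! (v - 1))"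
          using v by (intro el) auto
        then have "fst (last (G ! (v - 1))) \<le> d"
          using ogs_elementaryD(2)[OF e] ogs_elementaryD(4)[OF e, of "fst (last (G ! (v - 1)))"
            "snd (last (G ! (v - 1)))"] by simp
        moreover have "v - 1 < length G"
          using True v by auto
        ultimately show ?thesis
          using True xs(3) by (simp add: nth_append)
      next
        case False
        then show ?thesis
          using v G by (auto simp: ogs_elementary_presentation_iff nth_append)
      qed
    qed
    then show ?thesis
      using G(2) card by (intro exI[of _ "G @ [xs]"]) simp
  qed
qed

lemma card_des_le_length:
  assumes "ogs_elementary_presentation n q G"
  shows "card (des n q) \<le> length G"
proof -
  interpret elementary_factors n q G
    by unfold_locales (rule assms)
  have "card (des n q) \<le> card (fac_maj n G ` {1..length G})"
    using des_subset_fac_maj by (intro card_mono) auto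
  also have "\<dots> \<le> length G"
    using card_image_le[of "{1..length G}" "fac_maj n G"] by simp
  finally show ?thesis .
qed

theorem ogs_z_eq_card_des:
  assumes "q permutes {1..n}"
  shows "ogs_z n q = card (des n q)"
  unfolding ogs_z_def
proof (rule Least_equality)
  show "\<exists>G. ogs_elementary_presentation n q G \<and> length G = card (des n q)"
    by (rule presentation_exists[OF assms])
qed (use card_des_le_length in blast)

text \<open>A set with \<open>ogs_z\<close> elements is contained in the image of \<open>ogs_z\<close> numbers.\<close>
theorem fac_maj_bij_des:
  assumes "q permutes {1..n}" "ogs_elementary_factorization n q G"
  shows "bij_betw (fac_maj n G) {1..ogs_z n q} (des n q)"
proof -
  have G: "ogs_elementary_presentation n q G" "length G = ogs_z n q"
    using assms(2) by (auto simp: ogs_elementary_factorization_def)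
  interpret elementary_factors n q G
    by unfold_locales (rule G)
  have sub: "des n q \<subseteq> fac_maj n G ` {1..ogs_z n q}"
    using des_subset_fac_maj G(2) by simp
  have "card (fac_maj n G ` {1..ogs_z n q}) \<le> card (des n q)"
    using card_image_le[of "{1..ogs_z n q}" "fac_maj n G"] ogs_z_eq_card_des[OF assms(1)] by simp
  then have eq: "des n q = fac_maj n G ` {1..ogs_z n q}"
    using sub by (intro card_seteq) auto
  then have "card (fac_maj n G ` {1..ogs_z n q}) = card {1..ogs_z n q}"
    using ogs_z_eq_card_des[OF assms(1)] by simp
  then show ?thesis
    using eq by (simp add: bij_betw_def eq_card_imp_inj_on)
qed

section \<open>The inverse of a factorized permutation\<close>

theorem theorem3p50:
  fixes n :: nat and p :: "nat \<Rightarrow> nat" and F :: "ogs_word list"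
  assumes "p permutes {1..n}"
    and "p \<noteq> id"
    and "ogs_elementary_factorization n p F"
  shows
    "(\<exists>e :: nat \<Rightarrow> nat. \<exists>xs :: ogs_word.
       kappa_values n F \<subseteq> {1..n} \<and>
       xs = filter (\<lambda>(k, i). i \<noteq> 0) (map (\<lambda>k. (k, e k)) (sorted_list_of_set (kappa_values n F))) \<and>
       ogs_canonical n xs \<and> inv p = ogs_prod xs \<and>
       (\<forall>k\<in>kappa_values n F. \<forall>(v, j)\<in>fac_index F. k = kappa_plus n F v j \<longrightarrow>
          e k = (\<Sum>(w, x)\<in>{(w, x)\<in>fac_index F. kappa_plus n F w x = kappa_plus n F v j}.
                   theta n F w x + eta n F w x)) \<and>
       (\<forall>k\<in>kappa_values n F. \<forall>(v, j)\<in>fac_index F. k = kappa_minus n F v j \<longrightarrow>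
          int (e k) = int (kappa_minus n F v j) -
            (\<Sum>(w, x)\<in>{(w, x)\<in>fac_index F. kappa_minus n F w x = kappa_minus n F v j}.
                   int (theta n F w x) + int (eta n F w (x - 1))))) \<and>
     ogs_z n (inv p) = card (kappa_minus_values n F) \<and>
     (\<exists>G. ogs_elementary_factorization n (inv p) G) \<and>
     (\<forall>G. ogs_elementary_factorization n (inv p) G \<longrightarrow>
       (\<forall>w\<in>{1..ogs_z n (inv p)}. \<exists>(v, j)\<in>fac_index F. fac_maj n G w = kappa_minus n F v j) \<and>
       (\<forall>k\<in>kappa_minus_values n F. \<exists>!w. w \<in> {1..ogs_z n (inv p)} \<and> fac_maj n G w = k)) \<and>
     des n (inv p) = kappa_minus_values n F"
proof -
  interpret elementary_factors n p F
    using assms(3) by unfold_locales (simp add: ogs_elementary_factorization_def)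
  define e where "e = ogs_exponent (inv p)"
  define xs where
    "xs = filter (\<lambda>(k, i). i \<noteq> 0) (map (\<lambda>k. (k, e k)) (sorted_list_of_set (kappa_values n F)))"
  have perm: "inv p permutes {1..n}"
    using assms(1) by (rule permutes_inv)
  have canonical: "ogs_canonical n xs" "ogs_prod xs = inv p"
    unfolding xs_def e_def
    using ogs_canonical_form[OF perm kappa_values_subset exponent_outside_kappa_values] by simp_all
  have plus: "e k = (\<Sum>(w, x)\<in>{(w, x)\<in>fac_index F. kappa_plus n F w x = kappa_plus n F v j}.
      theta n F w x + eta n F w x)"
    if "(v, j) \<in> fac_index F" "k = kappa_plus n F v j" for k v j
    using exponent_kappa_plus[OF that(1)] that(2) by (simp add: e_def)
  have minus: "int (e k) = int (kappa_minus n F v j) -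
      (\<Sum>(w, x)\<in>{(w, x)\<in>fac_index F. kappa_minus n F w x = kappa_minus n F v j}.
        int (theta n F w x) + int (eta n F w (x - 1)))"
    if "k \<in> kappa_values n F" "(v, j) \<in> fac_index F" "k = kappa_minus n F v j" for k v j
  proof -
    let ?S = "{(w, x)\<in>fac_index F. kappa_minus n F w x = kappa_minus n F v j}"
    have "k \<noteq> 0"
      using that(1) by (simp add: kappa_values_def)
    then have "e k + (\<Sum>(w, x)\<in>?S. theta n F w x + eta n F w (x - 1)) = kappa_minus n F v j"
      using exponent_kappa_minus[OF that(2), of k] that(3) by (simp add: e_def)
    from arg_cong[OF this, of int]
    have "int (e k) + int (\<Sum>(w, x)\<in>?S. theta n F w x + eta n F w (x - 1)) =
        int (kappa_minus n F v j)"
      unfolding of_nat_add .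
    moreover have "int (\<Sum>(w, x)\<in>?S. theta n F w x + eta n F w (x - 1)) =
        (\<Sum>(w, x)\<in>?S. int (theta n F w x) + int (eta n F w (x - 1)))"
      unfolding of_nat_sum by (rule sum.cong) auto
    ultimately show ?thesis by simp
  qed
  have factor_majs: "(\<forall>w\<in>{1..ogs_z n (inv p)}. \<exists>(v, j)\<in>fac_index F. fac_maj n G w = kappa_minus n F v j) \<and>
      (\<forall>k\<in>kappa_minus_values n F. \<exists>!w. w \<in> {1..ogs_z n (inv p)} \<and> fac_maj n G w = k)"
    if G: "ogs_elementary_factorization n (inv p) G" for G
  proof (intro conjI ballI)
    have bij: "bij_betw (fac_maj n G) {1..ogs_z n (inv p)} (kappa_minus_values n F)"
      using fac_maj_bij_des[OF perm G] by (simp add: des_inv)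
    show "\<exists>(v, j)\<in>fac_index F. fac_maj n G w = kappa_minus n F v j" if "w \<in> {1..ogs_z n (inv p)}" for w
      using bij_betwE[OF bij, rule_format, OF that] by (auto simp: kappa_minus_values_def)
    fix k
    assume "k \<in> kappa_minus_values n F"
    then obtain w where w: "w \<in> {1..ogs_z n (inv p)}" "fac_maj n G w = k"
      unfolding bij_betw_imp_surj_on[OF bij, symmetric] by blast
    show "\<exists>!w. w \<in> {1..ogs_z n (inv p)} \<and> fac_maj n G w = k"
    proof (rule ex1I[of _ w])
      show "w' = w" if "w' \<in> {1..ogs_z n (inv p)} \<and> fac_maj n G w' = k" for w'
        using inj_onD[OF bij_betw_imp_inj_on[OF bij], of w' w] w that by simp
    qed (use w in simp)
  qed
  have z: "ogs_z n (inv p) = card (kappa_minus_values n F)"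
    using ogs_z_eq_card_des[OF perm] by (simp add: des_inv)
  have factorization: "\<exists>G. ogs_elementary_factorization n (inv p) G"
    using presentation_exists[OF perm] ogs_z_eq_card_des[OF perm]
    by (auto simp: ogs_elementary_factorization_def)
  have "\<forall>k\<in>kappa_values n F. \<forall>(v, j)\<in>fac_index F. k = kappa_plus n F v j \<longrightarrow>
      e k = (\<Sum>(w, x)\<in>{(w, x)\<in>fac_index F. kappa_plus n F w x = kappa_plus n F v j}.
        theta n F w x + eta n F w x)"
    using plus by blast
  moreover have "\<forall>k\<in>kappa_values n F. \<forall>(v, j)\<in>fac_index F. k = kappa_minus n F v j \<longrightarrow>
      int (e k) = int (kappa_minus n F v j) -
        (\<Sum>(w, x)\<in>{(w, x)\<in>fac_index F. kappa_minus n F w x = kappa_minus n F v j}.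
          int (theta n F w x) + int (eta n F w (x - 1)))"
    using minus by blast
  ultimately show ?thesis
    using factor_majs
    by (intro conjI exI[of _ e] exI[of _ xs] allI impI kappa_values_subset xs_def canonical
        canonical(2)[symmetric] z factorization des_inv) simp_all
qed

end
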